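(* Fix a function $f\in C^\infty\big((B_2\cap K_2)\backslash K_2\big)$. For $(\gamma_1,\gamma_2,\tau)\in(\mathbb{C}^\times)^3$ with $|\gamma_1\tau^{-1}|<q^{1/2}$ and $|\gamma_2^{-1}\tau|<q^{1/2}$, extend $f$ (uniquely) to an element of $\mathrm{Ind}(\xi)$, again denoted $f$, and regard $W(f)$ as an analytic function of $(\gamma_1,\gamma_2,\tau)$. This function has analytic continuation to all of $$\Lambda=\{(\gamma_1,\gamma_2,\tau)\in(\mathbb{C}^\times)^3:\ \tau\gamma_1^{-1}\neq q^{-1/2},\ \tau\gamma_2^{-1}\neq q^{1/2}\},$$ so that the domain of definition of $W:\mathrm{Ind}(\xi)\to\mathbb{C}$ may be extended to all parameters in $\Lambda$. If $(\gamma_1,\gamma_2,\tau)\in\Lambda$, then $W$ defines a (possibly zero) Waldspurger functional on $\mathrm{Ind}(\xi)$.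
   Context: $F$ is a nonarchimedean local field of characteristic different from $2$, with ring of integers $\mathcal{O}$, uniformizer $\varpi$, residue field of cardinality $q$, and absolute value normalized by $|\varpi|_F=q^{-1}$. $G_2=GL(2,F)$, $K_2=GL(2,\mathcal{O})$, $B_2\subset G_2$ is the group of upper triangular matrices, with modular character $\delta_{B_2}$; $T_2^{\mathrm s}$ is the group of diagonal matrices in $G_2$. $\xi_1,\xi_2,\sigma$ are unramified quasicharacters of $F^\times$ with $\xi_i(\varpi)=\gamma_i$ and $\sigma(\varpi)=\tau$. $\xi\begin{pmatrix}a&b\\0&d\end{pmatrix}=\xi_1(a)\xi_2(d)$, and $\mathrm{Ind}(\xi)$ is the space of locally constant $f:G_2\to\mathbb{C}$ with $f(bg)=\xi(b)\delta_{B_2}^{1/2}(b)f(g)$ for $b\in B_2$, $g\in G_2$, with $G_2$ acting by right translation $\pi_2$. $C^\infty((B_2\cap K_2)\backslash K_2)$ is the space of locally constant functions on $K_2$ that are left invariant by $B_2\cap K_2$; restriction to $K_2$ identifies $\mathrm{Ind}(\xi)$ with this space. Extend $\sigma$ to $T_2^{\mathrm s}$ by $\sigma\begin{pmatrix}ab&0\\0&b\end{pmatrix}=\sigma(a)\,\xi_1\xi_2(b)$. A Waldspurger functional on $\mathrm{Ind}(\xi)$ is here a linear functional $W$ with $W(\pi_2(t)v)=\sigma(t)W(v)$ for all $t\in T_2^{\mathrm s}$ and $v\in\mathrm{Ind}(\xi)$. For $|\gamma_1\tau^{-1}|<q^{1/2}$ and $|\gamma_2^{-1}\tau|<q^{1/2}$,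 $W$ is defined by the absolutely convergent integral $$W(f)=\int_{F^\times}f\left(\begin{pmatrix}0&1\\1&0\end{pmatrix}\begin{pmatrix}1&1\\0&1\end{pmatrix}\begin{pmatrix}a&0\\0&1\end{pmatrix}\right)\sigma^{-1}(a)\,d^\times a,$$ with $d^\times a$ the Haar measure giving $\mathcal{O}^\times$ measure $1$. *)

theory Defs
  imports "HOL-Analysis.Analysis" "HOL-Computational_Algebra.Computational_Algebra"
begin

section \<open>Nonarchimedean local fields\<close>

text \<open>
  The library's \<open>norm\<close> is constrained to real vector spaces, hence a separate constant for the
  absolute value.  The topology is the one of the metric \<open>dist x y = absv (x - y)\<close>.
\<close>

class field_absv = field +
  fixes absv :: "'a \<Rightarrow> real"
begin

definition int_ring :: "'a set" where
  "int_ring = {x. absv x \<le> 1}"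

definition residue_field :: "'a set set" where
  "residue_field =
     int_ring // {(x, y). x \<in> int_ring \<and> y \<in> int_ring \<and> absv (x - y) < 1}"

text \<open>A uniformizer is a generator of the maximal ideal of the ring of integers.\<close>

definition uniformizer :: "'a \<Rightarrow> bool" where
  "uniformizer p \<longleftrightarrow> p \<noteq> 0 \<and> {x. absv x < 1} = (*) p ` int_ring"

end

text \<open>
  A field that is complete for a discrete nonarchimedean absolute value with finite residue field,
  the absolute value being normalized.  Existence of a uniformizer is discreteness, and
  \<open>absv p = 1 / q\<close> with \<open>p \<noteq> 0\<close>, \<open>q \<ge> 2\<close> makes the absolute value nontrivial.
\<close>

class nonarch_local_field = field_absv + complete_space +
  assumes dist_absv: "dist x y = absv (x - y)"
    and absv_mult: "absv (x * y) = absv x * absv y"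
    and absv_ultrametric: "absv (x + y) \<le> max (absv x) (absv y)"
    and finite_residue_field: "finite (residue_field :: 'a set set)"
    and ex_normalized_uniformizer:
      "\<exists>p::'a. uniformizer p \<and> absv p = 1 / real (card (residue_field :: 'a set set))"

definition residue_card :: "'a::nonarch_local_field itself \<Rightarrow> real" where
  "residue_card _ = real (card (residue_field :: 'a set set))"

text \<open>
  The Haar measure of the multiplicative group with total mass 1 on the units of the ring of
  integers.  Regularity is not listed: it is automatic, as the group is locally compact and second
  countable and the measure is finite on compact sets.
\<close>

definition mult_haar :: "'a::nonarch_local_field measure \<Rightarrow> bool" where
  "mult_haar \<mu> \<longleftrightarrow>
     space \<mu> = - {0} \<and>
     sets \<mu> = sets (restrict_space borel (- {0})) \<and>
     (\<forall>c A. c \<noteq> 0 \<longrightarrow> A \<in> sets \<mu> \<longrightarrow> emeasure \<mu> ((*) c ` A) = emeasure \<mu> A) \<and>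
     (\<forall>C. compact C \<longrightarrow> C \<subseteq> - {0} \<longrightarrow> emeasure \<mu> C < \<infinity>) \<and>
     emeasure \<mu> {u. absv u = 1} = 1"

text \<open>
  Quasicharacters are total functions of which only the values on nonzero arguments matter.
\<close>

definition quasicharacter :: "('a::nonarch_local_field \<Rightarrow> complex) \<Rightarrow> bool" where
  "quasicharacter \<eta> \<longleftrightarrow>
     continuous_on (- {0}) \<eta> \<and>
     (\<forall>x. x \<noteq> 0 \<longrightarrow> \<eta> x \<noteq> 0) \<and>
     (\<forall>x y. x \<noteq> 0 \<longrightarrow> y \<noteq> 0 \<longrightarrow> \<eta> (x * y) = \<eta> x * \<eta> y)"

definition unramified :: "('a::nonarch_local_field \<Rightarrow> complex) \<Rightarrow> bool" where
  "unramified \<eta> \<longleftrightarrow> quasicharacter \<eta> \<and> (\<forall>u. absv u = 1 \<longrightarrow> \<eta> u = 1)"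


section \<open>The group $GL(2)$ and its subgroups\<close>

type_synonym 'a mat2 = "'a ^ 2 ^ 2"

text \<open>
  Subsets of the matrix space, with the subspace topology; this is the group topology, as inversion
  is continuous on invertible matrices.
\<close>

definition mat2 :: "'a \<Rightarrow> 'a \<Rightarrow> 'a \<Rightarrow> 'a \<Rightarrow> 'a::zero mat2" where
  "mat2 a b c d = vector [vector [a, b], vector [c, d]]"

definition G2 :: "'a::nonarch_local_field mat2 set" where
  "G2 = {g. invertible g}"

definition K2 :: "'a::nonarch_local_field mat2 set" where
  "K2 = {k. (\<forall>i j. k $ i $ j \<in> int_ring) \<and>
            (\<exists>h. (\<forall>i j. h $ i $ j \<in> int_ring) \<and> k ** h = mat 1 \<and> h ** k = mat 1)}"

definition B2 :: "'a::nonarch_local_field mat2 set" where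
  "B2 = {b \<in> G2. b $ 2 $ 1 = 0}"

definition T2 :: "'a::nonarch_local_field mat2 set" where
  "T2 = {t \<in> G2. t $ 1 $ 2 = 0 \<and> t $ 2 $ 1 = 0}"

text \<open>
  The modular character of \<open>B2\<close>, normalized so that \<open>Ind\<close> below is normalized induction:
  the modulus of \<open>x \<mapsto> (a/d) x\<close>, that is, of conjugation on the unipotent radical.
\<close>

definition modular_B2 :: "'a::nonarch_local_field mat2 \<Rightarrow> real" where
  "modular_B2 b = absv (b $ 1 $ 1 / b $ 2 $ 2)"

definition locally_constant_on :: "'a::topological_space set \<Rightarrow> ('a \<Rightarrow> 'b) \<Rightarrow> bool" where
  "locally_constant_on S f \<longleftrightarrow> locally (\<lambda>U. f constant_on U) S"


section \<open>The induced representation and Waldspurger functionals\<close>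

text \<open>
  Functions on \<open>G2\<close> and on \<open>K2\<close> are encoded as functions on all matrices that vanish outside
  the respective group, so that equality of functions has the intended meaning.
\<close>

definition Ind :: "('a::nonarch_local_field \<Rightarrow> complex) \<Rightarrow> ('a \<Rightarrow> complex) \<Rightarrow> ('a mat2 \<Rightarrow> complex) set" where
  "Ind \<xi>1 \<xi>2 = {f.
     (\<forall>g. g \<notin> G2 \<longrightarrow> f g = 0) \<and>
     locally_constant_on G2 f \<and>
     (\<forall>b\<in>B2. \<forall>g\<in>G2. f (b ** g) =
        \<xi>1 (b $ 1 $ 1) * \<xi>2 (b $ 2 $ 2) * complex_of_real (sqrt (modular_B2 b)) * f g)}"

definition right_translate ::
    "'a::nonarch_local_field mat2 \<Rightarrow> ('a mat2 \<Rightarrow> complex) \<Rightarrow> 'a mat2 \<Rightarrow> complex" where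
  "right_translate h f = (\<lambda>g. f (g ** h))"

definition Cinf_K2 :: "('a::nonarch_local_field mat2 \<Rightarrow> complex) set" where
  "Cinf_K2 = {f.
     (\<forall>k. k \<notin> K2 \<longrightarrow> f k = 0) \<and>
     locally_constant_on K2 f \<and>
     (\<forall>b\<in>B2 \<inter> K2. \<forall>k\<in>K2. f (b ** k) = f k)}"

definition restrict_K2 :: "('a::nonarch_local_field mat2 \<Rightarrow> complex) \<Rightarrow> 'a mat2 \<Rightarrow> complex" where
  "restrict_K2 f = (\<lambda>k. if k \<in> K2 then f k else 0)"

text \<open>The extension of \<open>\<sigma>\<close> to \<open>T2\<close>: a diagonal matrix is written as \<open>diag(ab, b)\<close>.\<close>

definition torus_char ::
    "('a::nonarch_local_field \<Rightarrow> complex) \<Rightarrow> ('a \<Rightarrow> complex) \<Rightarrow> ('a \<Rightarrow> complex) \<Rightarrow> 'a mat2 \<Rightarrow> complex" where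
  "torus_char \<xi>1 \<xi>2 \<sigma> t =
     (let b = t $ 2 $ 2; a = t $ 1 $ 1 / b in \<sigma> a * (\<xi>1 b * \<xi>2 b))"

definition waldspurger_functional ::
    "('a::nonarch_local_field \<Rightarrow> complex) \<Rightarrow> ('a \<Rightarrow> complex) \<Rightarrow> ('a \<Rightarrow> complex) \<Rightarrow>
     (('a mat2 \<Rightarrow> complex) \<Rightarrow> complex) \<Rightarrow> bool" where
  "waldspurger_functional \<xi>1 \<xi>2 \<sigma> W \<longleftrightarrow>
     (\<forall>u\<in>Ind \<xi>1 \<xi>2. \<forall>v\<in>Ind \<xi>1 \<xi>2. W (\<lambda>g. u g + v g) = W u + W v) \<and>
     (\<forall>c. \<forall>v\<in>Ind \<xi>1 \<xi>2. W (\<lambda>g. c * v g) = c * W v) \<and>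
     (\<forall>t\<in>T2. \<forall>v\<in>Ind \<xi>1 \<xi>2. W (right_translate t v) = torus_char \<xi>1 \<xi>2 \<sigma> t * W v)"

definition W_integrand ::
    "('a::nonarch_local_field \<Rightarrow> complex) \<Rightarrow> ('a mat2 \<Rightarrow> complex) \<Rightarrow> 'a \<Rightarrow> complex" where
  "W_integrand \<sigma> f a = f (mat2 0 1 1 0 ** mat2 1 1 0 1 ** mat2 a 0 0 1) * inverse (\<sigma> a)"

definition W_integral ::
    "'a::nonarch_local_field measure \<Rightarrow> ('a \<Rightarrow> complex) \<Rightarrow> ('a mat2 \<Rightarrow> complex) \<Rightarrow> complex" where
  "W_integral \<mu> \<sigma> f = (LINT a|\<mu>. W_integrand \<sigma> f a)"


section \<open>Parameters and analytic continuation\<close>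

definition has_parameters ::
    "'a::nonarch_local_field \<Rightarrow> ('a \<Rightarrow> complex) \<Rightarrow> ('a \<Rightarrow> complex) \<Rightarrow> ('a \<Rightarrow> complex) \<Rightarrow>
     complex \<times> complex \<times> complex \<Rightarrow> bool" where
  "has_parameters p \<xi>1 \<xi>2 \<sigma> z \<longleftrightarrow>
     unramified \<xi>1 \<and> unramified \<xi>2 \<and> unramified \<sigma> \<and> z = (\<xi>1 p, \<xi>2 p, \<sigma> p)"

definition convergence_domain :: "real \<Rightarrow> (complex \<times> complex \<times> complex) set" where
  "convergence_domain q = {(\<gamma>1, \<gamma>2, \<tau>). \<gamma>1 \<noteq> 0 \<and> \<gamma>2 \<noteq> 0 \<and> \<tau> \<noteq> 0 \<and>
     norm (\<gamma>1 * inverse \<tau>) < q powr (1/2) \<and> norm (inverse \<gamma>2 * \<tau>) < q powr (1/2)}"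

definition Lambda_domain :: "real \<Rightarrow> (complex \<times> complex \<times> complex) set" where
  "Lambda_domain q = {(\<gamma>1, \<gamma>2, \<tau>). \<gamma>1 \<noteq> 0 \<and> \<gamma>2 \<noteq> 0 \<and> \<tau> \<noteq> 0 \<and>
     \<tau> * inverse \<gamma>1 \<noteq> complex_of_real (q powr (-1/2)) \<and>
     \<tau> * inverse \<gamma>2 \<noteq> complex_of_real (q powr (1/2))}"

text \<open>
  The analogue of \<^const>\<open>analytic_on\<close> in three variables: near every point of the set the function
  is complex differentiable, i.e. it has a Frechet derivative that is complex linear.
\<close>

definition analytic_on3 ::
    "(complex \<times> complex \<times> complex \<Rightarrow> complex) \<Rightarrow> (complex \<times> complex \<times> complex) set \<Rightarrow> bool" where
  "analytic_on3 F S \<longleftrightarrow>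
     (\<forall>z\<in>S. \<exists>e>0. \<forall>w\<in>ball z e. \<exists>a b c.
        (F has_derivative (\<lambda>(x, y, t). a * x + b * y + c * t)) (at w))"

definition Ind_extension ::
    "('a::nonarch_local_field \<Rightarrow> complex) \<Rightarrow> ('a \<Rightarrow> complex) \<Rightarrow> ('a mat2 \<Rightarrow> complex) \<Rightarrow>
     ('a mat2 \<Rightarrow> complex) \<Rightarrow> bool" where
  "Ind_extension \<xi>1 \<xi>2 f \<phi> \<longleftrightarrow> \<phi> \<in> Ind \<xi>1 \<xi>2 \<and> (\<forall>k\<in>K2. \<phi> k = f k)"

text \<open>\<open>A\<close> continues the function \<open>W(f)\<close> of the parameters analytically to the whole domain.\<close>

definition W_continuation ::
    "'a::nonarch_local_field \<Rightarrow> 'a measure \<Rightarrow> ('a mat2 \<Rightarrow> complex) \<Rightarrow>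
     (complex \<times> complex \<times> complex \<Rightarrow> complex) \<Rightarrow> bool" where
  "W_continuation p \<mu> f A \<longleftrightarrow>
     analytic_on3 A (Lambda_domain (residue_card TYPE('a))) \<and>
     (\<forall>z\<in>convergence_domain (residue_card TYPE('a)). \<forall>\<xi>1 \<xi>2 \<sigma> \<phi>.
        has_parameters p \<xi>1 \<xi>2 \<sigma> z \<longrightarrow> Ind_extension \<xi>1 \<xi>2 f \<phi> \<longrightarrow> A z = W_integral \<mu> \<sigma> \<phi>)"

end

theory Submission
  imports Defs "HOL-Complex_Analysis.Complex_Analysis"
begin

text \<open>
  Put \<open>x = \<gamma>1 \<tau>\<^sup>-\<^sup>1 q\<^sup>-\<^sup>1\<^sup>/\<^sup>2\<close> and \<open>y = \<gamma>2\<^sup>-\<^sup>1 \<tau> q\<^sup>-\<^sup>1\<^sup>/\<^sup>2\<close>.  By the Iwasawa decomposition the integrand of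
  \<open>W(f)\<close> at \<open>a\<close> of valuation \<open>n\<close> is \<open>x ^ n\<close> (if \<open>n \<ge> 0\<close>) or \<open>y ^ (- n)\<close> (if \<open>n < 0\<close>) times a
  value of \<open>f\<close> on \<open>K2\<close>, and by local constancy this value does not depend on \<open>a\<close> when the absolute
  value of \<open>n\<close> is large.  With \<open>S\<close> the shift \<open>\<Psi> \<mapsto> \<Psi>(\<cdot>/p)\<close>, the operator \<open>(1 - xS)(y - S)\<close>
  therefore makes the support of the integrand compact.  The integral of the result is a polynomial in
  \<open>x\<close> and \<open>y\<close>, and by invariance of the Haar measure it equals \<open>(1 - x)(y - 1) W(f)\<close> where \<open>W(f)\<close>
  converges; dividing by \<open>(1 - x)(y - 1)\<close> gives the continuation.  The torus acts on the integrand
  through translations of \<open>a\<close>, which commute with \<open>S\<close> and preserve the measure, and this gives the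
  equivariance.  A continuation is unique by the identity theorem, applied in \<open>\<gamma>1\<close> and then in \<open>\<gamma>2\<close>.
\<close>

section \<open>The absolute value and the valuation\<close>

text \<open>The integral converges for \<open>norm x < 1\<close> and \<open>norm y < 1\<close>, and
  the two hypersurfaces removed in \<open>Lambda_domain\<close> are exactly \<open>x = 1\<close> and
  \<open>y = 1\<close>, the possible poles of the two geometric tails. The second factor is
  \<open>y - S\<close> and not \<open>1 - y S^-1\<close> so that all shifts go in one direction; the
  product is \<open>y - (x y + 1) S + x S^2\<close>. Equivariance cannot be obtained by continuing
  an identity for one fixed \<open>f\<close>: the restriction to \<open>K2\<close> of a torus
  translate of the extension of \<open>f\<close> varies with the parameters. The regularized
  integral avoids this. It converges at each single parameter and can be written with
  \<open>W_integrand\<close> of the induced function itself, so linearity and equivariance are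
  checked with the parameters fixed. A continuation is chosen separately for each \<open>f\<close>,
  with no relation between different \<open>f\<close>; only uniqueness leads back to the regularized
  formula. Uniqueness in turn uses that unramified characters with prescribed nonzero values and
  extensions of \<open>f\<close> exist, since otherwise the values of a continuation would not be
  tied to an integral.\<close>

lemma absv_0 [simp]: "absv (0::'a::nonarch_local_field) = 0"
  by (metis dist_absv dist_self diff_self)

lemma absv_nonneg [simp]: "0 \<le> absv (x::'a::nonarch_local_field)"
  using zero_le_dist[of x 0] by (simp add: dist_absv)

lemma absv_eq_0_iff [simp]: "absv (x::'a::nonarch_local_field) = 0 \<longleftrightarrow> x = 0"
  by (metis dist_absv dist_eq_0_iff diff_0_right)

lemma absv_pos_iff [simp]: "0 < absv (x::'a::nonarch_local_field) \<longleftrightarrow> x \<noteq> 0"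
  by (metis absv_eq_0_iff absv_nonneg less_le)

lemma absv_1 [simp]: "absv (1::'a::nonarch_local_field) = 1"
  by (metis absv_eq_0_iff absv_mult mult_cancel_left1 mult_1 zero_neq_one)

lemma absv_minus [simp]: "absv (- x::'a::nonarch_local_field) = absv x"
  by (metis dist_absv dist_commute diff_0 diff_0_right)

lemma absv_inverse: "absv (inverse x::'a::nonarch_local_field) = inverse (absv x)"
proof (cases "x = 0")
  case False
  then have "absv x * absv (inverse x) = 1"
    by (simp flip: absv_mult)
  then show ?thesis
    by (metis inverse_unique)
qed auto

lemma absv_divide: "absv (x / y::'a::nonarch_local_field) = absv x / absv y"
  by (simp add: divide_inverse absv_mult absv_inverse)

lemma absv_power: "absv (x ^ n::'a::nonarch_local_field) = absv x ^ n"
  by (induction n) (auto simp: absv_mult)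

lemma absv_power_int: "absv (x powi n::'a::nonarch_local_field) = absv x powi n"
  by (simp add: power_int_def absv_power absv_inverse)

lemma absv_diff_le: "absv (x - y) \<le> max (absv x) (absv (y::'a::nonarch_local_field))"
  using absv_ultrametric[of x "- y"] by simp

text \<open>The isosceles triangle principle: of \<open>x\<close>, \<open>y\<close> and
  \<open>x - y\<close>, the two largest in absolute value have equal absolute values.\<close>

lemma absv_eq_of_close:
  fixes x y :: "'a::nonarch_local_field"
  assumes "absv (x - y) < absv y"
  shows "absv x = absv y"
proof -
  have "absv x \<le> max (absv (x - y)) (absv y)"
    using absv_ultrametric[of "x - y" y] by simp
  moreover have "absv y \<le> max (absv x) (absv (x - y))"
    using absv_diff_le[of x "x - y"] by simp
  ultimately show ?thesis
    using assms by linarith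
qed

lemma tendsto_absv_iff:
  fixes f :: "'b \<Rightarrow> 'a::nonarch_local_field"
  shows "(f \<longlongrightarrow> l) F \<longleftrightarrow> (\<forall>e>0. \<forall>\<^sub>F x in F. absv (f x - l) < e)"
  by (simp add: tendsto_iff dist_absv)

section \<open>Continuity of the field operations; open and closed sets\<close>

instance nonarch_local_field \<subseteq> topological_ab_group_add
proof
  fix a b :: 'a
  have "\<forall>\<^sub>F x in nhds a \<times>\<^sub>F nhds b. absv (fst x + snd x - (a + b)) < e" if "e > 0" for e
  proof -
    have "\<forall>\<^sub>F x in nhds a. absv (x - a) < e" "\<forall>\<^sub>F x in nhds b. absv (x - b) < e"
      using that by (auto simp: eventually_nhds_metric dist_absv)
    then have "\<forall>\<^sub>F x in nhds a \<times>\<^sub>F nhds b. absv (fst x - a) < e \<and> absv (snd x - b) < e"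
      by (simp add: eventually_prod_filter) (metis fst_conv snd_conv)
    then show ?thesis
    proof eventually_elim
      case (elim x)
      have "absv (fst x + snd x - (a + b)) \<le> max (absv (fst x - a)) (absv (snd x - b))"
        using absv_ultrametric[of "fst x - a" "snd x - b"] by (simp only: add_diff_add)
      also have "\<dots> < e"
        using elim by simp
      finally show ?case .
    qed
  qed
  then show "((\<lambda>x. fst x + snd x) \<longlongrightarrow> a + b) (nhds a \<times>\<^sub>F nhds b)"
    by (simp add: tendsto_absv_iff)
  have "absv (- x - - a) = absv (x - a)" for x
    by (metis absv_minus minus_diff_eq minus_diff_minus)
  then show "(uminus \<longlongrightarrow> - a) (nhds a)"
    by (simp only: tendsto_absv_iff) (simp add: eventually_nhds_metric dist_absv, blast)
qed

instance nonarch_local_field \<subseteq> topological_semigroup_mult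
proof
  fix a b :: 'a
  have "\<forall>\<^sub>F x in nhds a \<times>\<^sub>F nhds b. absv (fst x * snd x - a * b) < e" if "e > 0" for e
  proof -
    \<comment> \<open>The error is a sum of three products, bounded by \<open>d * d\<close>,
      \<open>d * absv b\<close> and \<open>d * absv a\<close>. With \<open>d \<le> 1\<close> the
      first is below \<open>d\<close>, and each is below \<open>e\<close> because
      \<open>d + d * absv a + d * absv b \<le> e\<close> and \<open>d > 0\<close>.\<close>
    define d where "d = min 1 (e / (1 + absv a + absv b))"
    have pos: "1 + absv a + absv b > 0"
      by (simp add: add_pos_nonneg)
    have d: "0 < d" "d \<le> 1"
      using that pos by (auto simp: d_def)
    have "d \<le> e / (1 + absv a + absv b)"
      by (simp add: d_def)
    then have d_le: "d * (1 + absv a + absv b) \<le> e"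
      using pos by (simp add: pos_le_divide_eq)
    have "\<forall>\<^sub>F x in nhds a. absv (x - a) < d" "\<forall>\<^sub>F x in nhds b. absv (x - b) < d"
      using d by (auto simp: eventually_nhds_metric dist_absv)
    then have "\<forall>\<^sub>F x in nhds a \<times>\<^sub>F nhds b. absv (fst x - a) < d \<and> absv (snd x - b) < d"
      by (simp add: eventually_prod_filter) (metis fst_conv snd_conv)
    then show ?thesis
    proof eventually_elim
      case (elim x)
      have "fst x * snd x - a * b = (fst x - a) * (snd x - b) + ((fst x - a) * b + a * (snd x - b))"
        by (simp add: algebra_simps)
      then have "absv (fst x * snd x - a * b)
          \<le> max (absv ((fst x - a) * (snd x - b))) (absv ((fst x - a) * b + a * (snd x - b)))"
        by (metis absv_ultrametric)
      also have "\<dots> \<le> max (absv ((fst x - a) * (snd x - b)))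
                         (max (absv ((fst x - a) * b)) (absv (a * (snd x - b))))"
        using absv_ultrametric[of "(fst x - a) * b" "a * (snd x - b)"] by linarith
      also have "\<dots> = max (absv (fst x - a) * absv (snd x - b))
                         (max (absv (fst x - a) * absv b) (absv a * absv (snd x - b)))"
        by (simp add: absv_mult)
      also have "\<dots> < e"
      proof -
        have "absv (fst x - a) * absv (snd x - b) < d * 1"
          using elim d by (intro mult_strict_mono') auto
        moreover have "absv (fst x - a) * absv b \<le> d * absv b"
          using elim by (intro mult_right_mono) auto
        moreover have "absv a * absv (snd x - b) \<le> d * absv a"
          using elim by (subst mult.commute, intro mult_right_mono) auto
        moreover have "0 \<le> d * absv a" "0 \<le> d * absv b"
          using d by auto
        moreover have "d + d * absv a + d * absv b \<le> e"
          using d_le by (simp add: algebra_simps)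
        ultimately show ?thesis
          unfolding max_less_iff_conj using d by linarith
      qed
      finally show ?case .
    qed
  qed
  then show "((\<lambda>x. fst x * snd x) \<longlongrightarrow> a * b) (nhds a \<times>\<^sub>F nhds b)"
    by (simp add: tendsto_absv_iff)
qed

lemma continuous_on_absv [continuous_intros]:
  fixes f :: "'b::topological_space \<Rightarrow> 'a::nonarch_local_field"
  assumes "continuous_on S f"
  shows "continuous_on S (\<lambda>x. absv (f x))"
proof -
  have "continuous_on S (\<lambda>x. dist (f x) 0)"
    using assms by (intro continuous_intros)
  then show ?thesis
    by (simp add: dist_absv)
qed

text \<open>Spheres around 0 are open in an ultrametric: every point closer to \<open>x\<close> than
  \<open>absv x\<close> has the absolute value of \<open>x\<close>. The sphere of radius 0 is the
  exception, hence the condition on 0.\<close>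

lemma open_absv_eq:
  fixes S :: "'a::nonarch_local_field set"
  assumes "\<And>x y. x \<in> S \<Longrightarrow> absv y = absv x \<Longrightarrow> y \<in> S" and "0 \<notin> S"
  shows "open S"
  unfolding open_dist
proof safe
  fix x assume "x \<in> S"
  then have "absv x > 0"
    using assms(2) by auto
  then show "\<exists>e>0. \<forall>y. dist y x < e \<longrightarrow> y \<in> S"
    using assms(1)[OF \<open>x \<in> S\<close>] absv_eq_of_close
    by (intro exI[of _ "absv x"]) (auto simp: dist_absv)
qed

lemma open_int_ring: "open (int_ring :: 'a::nonarch_local_field set)"
proof -
  have "y \<in> int_ring" if "x \<in> int_ring" "dist y x < 1" for x y :: 'a
    using that absv_ultrametric[of "y - x" x] by (auto simp: int_ring_def dist_absv)
  then show ?thesis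
    unfolding open_dist by (meson zero_less_one)
qed

lemma closed_int_ring: "closed (int_ring :: 'a::nonarch_local_field set)"
  unfolding int_ring_def by (intro closed_Collect_le continuous_intros)

lemma continuous_on_inverse_absv [continuous_intros]:
  fixes f :: "'b::topological_space \<Rightarrow> 'a::nonarch_local_field"
  assumes "continuous_on S f" "\<And>x. x \<in> S \<Longrightarrow> f x \<noteq> 0"
  shows "continuous_on S (\<lambda>x. inverse (f x))"
proof -
  have "((\<lambda>x. inverse x) \<longlongrightarrow> inverse a) (nhds a)" if "a \<noteq> 0" for a :: 'a
    unfolding tendsto_absv_iff
  proof safe
    fix e :: real assume "e > 0"
    \<comment> \<open>The first bound forces \<open>absv x = absv a\<close>, so the denominator
      \<open>x * a\<close> has absolute value \<open>absv a ^ 2\<close>, which the second bound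
      compensates.\<close>
    have "\<forall>\<^sub>F x in nhds a. absv (x - a) < min (absv a) (e * absv a ^ 2)"
      using that \<open>e > 0\<close>
      by (subst eventually_nhds_metric, intro exI[of _ "min (absv a) (e * absv a ^ 2)"])
        (auto simp: dist_absv)
    then show "\<forall>\<^sub>F x in nhds a. absv (inverse x - inverse a) < e"
    proof eventually_elim
      case (elim x)
      then have "absv x = absv a"
        using absv_eq_of_close by auto
      then have "x \<noteq> 0"
        using that by auto
      then have "inverse x - inverse a = - ((x - a) / (x * a))"
        using that by (simp add: field_simps)
      then have "absv (inverse x - inverse a) = absv (x - a) / (absv a) ^ 2"
        using \<open>absv x = absv a\<close> by (simp only: absv_minus absv_divide absv_mult power2_eq_square)
      then show ?case
        using elim that by (simp only:) (simp add: pos_divide_less_eq)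
    qed
  qed
  then show ?thesis
    using assms unfolding continuous_on_def by (metis tendsto_compose_filtermap filterlim_compose)
qed

section \<open>Uniformizers and discreteness of the absolute value\<close>

lemma residue_card_ge_2: "residue_card TYPE('a::nonarch_local_field) \<ge> 2"
proof -
  define R where "R = {(x::'a, y). x \<in> int_ring \<and> y \<in> int_ring \<and> absv (x - y) < 1}"
  have "R `` {0} \<in> residue_field" "R `` {1} \<in> residue_field"
    unfolding residue_field_def R_def[symmetric] by (auto intro!: quotientI simp: int_ring_def)
  moreover have "R `` {0} \<noteq> R `` {1}"
  proof -
    have "0 \<in> R `` {0}" "0 \<notin> R `` {1}"
      by (auto simp: R_def int_ring_def)
    then show ?thesis by auto
  qed
  ultimately have "card {R `` {0}, R `` {1}} \<le> card (residue_field :: 'a set set)"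
    by (intro card_mono finite_residue_field) auto
  then show ?thesis
    using \<open>R `` {0} \<noteq> R `` {1}\<close> by (simp add: residue_card_def)
qed

lemma residue_card_pos: "residue_card TYPE('a::nonarch_local_field) > 0"
  using residue_card_ge_2[where 'a='a] by simp

lemma uniformizer_nonzero: "uniformizer (p::'a::nonarch_local_field) \<Longrightarrow> p \<noteq> 0"
  by (simp add: uniformizer_def)

lemma uniformizer_absv_lt:
  fixes p x :: "'a::nonarch_local_field"
  assumes "uniformizer p" "absv x < 1"
  shows "absv x \<le> absv p"
proof -
  have "x \<in> (*) p ` int_ring"
    using assms by (auto simp: uniformizer_def)
  then obtain y where "x = p * y" "absv y \<le> 1"
    by (auto simp: int_ring_def)
  then show ?thesis
    by (simp add: absv_mult mult_left_le)
qed

lemma uniformizer_absv_less_1: "uniformizer (p::'a::nonarch_local_field) \<Longrightarrow> absv p < 1"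
proof -
  assume p: "uniformizer p"
  have "p * 1 \<in> (*) p ` int_ring"
    by (rule imageI) (simp add: int_ring_def)
  then show ?thesis
    using p by (simp add: uniformizer_def set_eq_iff)
qed

text \<open>The class provides one normalized uniformizer only. Any two have the same absolute
  value, since each attains the largest absolute value below 1.\<close>

lemma absv_uniformizer:
  assumes "uniformizer (p::'a::nonarch_local_field)"
  shows "absv p = inverse (residue_card TYPE('a))"
proof -
  obtain p' :: 'a where p': "uniformizer p'" "absv p' = 1 / real (card (residue_field :: 'a set set))"
    using ex_normalized_uniformizer by blast
  have "absv p = absv p'"
    using assms p' by (intro antisym uniformizer_absv_lt uniformizer_absv_less_1)
  then show ?thesis
    using p' by (simp add: residue_card_def divide_inverse)
qed

text \<open>Rounding the logarithm yields \<open>n\<close> such that the absolute value of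
  \<open>a / p powi n\<close> lies above \<open>absv p\<close> and is at most 1. No value lies
  strictly between \<open>absv p\<close> and 1, so the quotient is a unit.\<close>

lemma ex_absv_powi:
  assumes "(a::'a::nonarch_local_field) \<noteq> 0"
  shows "\<exists>n. absv a = residue_card TYPE('a) powi (- n)"
proof -
  obtain p :: 'a where p: "uniformizer p"
    using ex_normalized_uniformizer by blast
  let ?q = "residue_card TYPE('a)"
  have q: "?q > 1"
    using residue_card_ge_2[where 'a='a] by simp
  define n where "n = \<lfloor>- log ?q (absv a)\<rfloor>"
  have le: "of_int n \<le> - log ?q (absv a)" "- log ?q (absv a) < of_int n + 1"
    by (auto simp: n_def)
  have a: "absv a = ?q powr (log ?q (absv a))"
    using assms q by simp
  have pn: "absv (p powi n) = ?q powr (- of_int n)"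
    using q by (simp add: absv_power_int absv_uniformizer[OF p] powr_minus powr_real_of_int'
        power_int_inverse)
  have "absv a \<le> absv (p powi n)"
  proof -
    have "?q powr (log ?q (absv a)) \<le> ?q powr (- of_int n)"
      using le q by (intro powr_mono) auto
    then show ?thesis
      unfolding pn using a by simp
  qed
  moreover have "absv (p powi n) * absv p < absv a"
  proof -
    have "absv (p powi n) * absv p = ?q powr (- of_int n - 1)"
      unfolding pn using q by (simp add: absv_uniformizer[OF p] powr_diff divide_inverse)
    also have "\<dots> < ?q powr (log ?q (absv a))"
      using le q by (intro powr_less_mono) auto
    finally show ?thesis using a by simp
  qed
  ultimately have "absv (a / p powi n) \<le> 1" "absv p < absv (a / p powi n)"
    using uniformizer_nonzero[OF p] by (auto simp: absv_divide field_simps)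
  then have "absv (a / p powi n) = 1"
    using uniformizer_absv_lt[OF p, of "a / p powi n"] by linarith
  then have "absv a = absv (p powi n)"
    using uniformizer_nonzero[OF p] by (simp add: absv_divide)
  then show ?thesis
    using q by (auto simp: absv_power_int absv_uniformizer[OF p] power_int_inverse power_int_minus)
qed

text \<open>The sign makes the valuation of a uniformizer equal to 1. No exponent exists for 0,
  where the value is arbitrary; this is why sets and identities that involve \<open>val\<close>
  exclude 0.\<close>

definition val :: "'a::nonarch_local_field \<Rightarrow> int" where
  "val a = (THE n. absv a = residue_card TYPE('a) powi (- n))"

lemma residue_card_powi_inject:
  "residue_card TYPE('a::nonarch_local_field) powi m = residue_card TYPE('a) powi n \<longleftrightarrow> m = n"
proof -
  have "residue_card TYPE('a) > 1"
    using residue_card_ge_2[where 'a='a] by simp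
  then show ?thesis
    by (metis antisym_conv3 less_irrefl power_int_strict_increasing)
qed

lemma absv_val:
  assumes "(a::'a::nonarch_local_field) \<noteq> 0"
  shows "absv a = residue_card TYPE('a) powi (- val a)"
proof -
  have "\<exists>!n. absv a = residue_card TYPE('a) powi (- n)"
    using ex_absv_powi[OF assms] by (metis residue_card_powi_inject neg_equal_iff_equal)
  then show ?thesis
    unfolding val_def by (rule theI')
qed

lemma val_eqI:
  assumes "absv (a::'a::nonarch_local_field) = residue_card TYPE('a) powi (- n)"
  shows "val a = n"
proof -
  have "a \<noteq> 0"
    using assms residue_card_pos[where 'a='a] by (metis absv_0 power_int_eq_0_iff less_irrefl)
  then show ?thesis
    using absv_val[of a] assms by (simp add: residue_card_powi_inject)
qed

lemma val_mult: "(a::'a::nonarch_local_field) \<noteq> 0 \<Longrightarrow> b \<noteq> 0 \<Longrightarrow> val (a * b) = val a + val b"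
  using residue_card_pos[where 'a='a]
  by (intro val_eqI) (simp add: absv_mult absv_val power_int_diff power_int_minus power_int_add
      divide_inverse)

lemma val_inverse: "(a::'a::nonarch_local_field) \<noteq> 0 \<Longrightarrow> val (inverse a) = - val a"
  by (intro val_eqI) (simp add: absv_inverse absv_val power_int_minus)

lemma val_divide: "(a::'a::nonarch_local_field) \<noteq> 0 \<Longrightarrow> b \<noteq> 0 \<Longrightarrow> val (a / b) = val a - val b"
  by (simp add: divide_inverse val_mult val_inverse)

lemma val_1 [simp]: "val (1::'a::nonarch_local_field) = 0"
  by (intro val_eqI) simp

lemma val_uniformizer: "uniformizer (p::'a::nonarch_local_field) \<Longrightarrow> val p = 1"
  by (intro val_eqI) (simp add: absv_uniformizer power_int_minus)

lemma val_power: "(a::'a::nonarch_local_field) \<noteq> 0 \<Longrightarrow> val (a ^ n) = int n * val a"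
  by (induction n) (auto simp: val_mult algebra_simps)

lemma val_powi: "(a::'a::nonarch_local_field) \<noteq> 0 \<Longrightarrow> val (a powi n) = n * val a"
  by (simp add: power_int_def val_power val_inverse)

lemma absv_le_iff_val:
  assumes "(a::'a::nonarch_local_field) \<noteq> 0" "(b::'a) \<noteq> 0"
  shows "absv a \<le> absv b \<longleftrightarrow> val b \<le> val a"
proof -
  have q: "residue_card TYPE('a) > 1"
    using residue_card_ge_2[where 'a='a] by simp
  show ?thesis
    using assms power_int_increasing[of "- val a" "- val b", OF _ less_imp_le[OF q]]
      power_int_strict_increasing[of "- val b" "- val a", OF _ q]
    by (auto simp: absv_val not_le[symmetric])
qed

lemma absv_eq_iff_val:
  assumes "(a::'a::nonarch_local_field) \<noteq> 0" "(b::'a) \<noteq> 0"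
  shows "absv a = absv b \<longleftrightarrow> val a = val b"
  using absv_le_iff_val[OF assms] absv_le_iff_val[OF assms(2,1)] by auto

lemma absv_le_1_iff_val: "(a::'a::nonarch_local_field) \<noteq> 0 \<Longrightarrow> absv a \<le> 1 \<longleftrightarrow> 0 \<le> val a"
  using absv_le_iff_val[of a 1] by simp

lemma absv_eq_1_iff_val: "(a::'a::nonarch_local_field) \<noteq> 0 \<Longrightarrow> absv a = 1 \<longleftrightarrow> val a = 0"
  using absv_eq_iff_val[of a 1] by simp

lemma open_val: "open {a::'a::nonarch_local_field. a \<noteq> 0 \<and> P (val a)}"
proof (rule open_absv_eq)
  fix x y :: 'a
  assume "x \<in> {a. a \<noteq> 0 \<and> P (val a)}" "absv y = absv x"
  then show "y \<in> {a. a \<noteq> 0 \<and> P (val a)}"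
    using absv_eq_iff_val[of y x] by (cases "y = 0") auto
qed auto

section \<open>Compactness of the ring of integers\<close>

text \<open>Expansion in digits: subtracting a representative of its residue class from
  \<open>y\<close> leaves a multiple of \<open>p\<close>, and approximating the integral cofactor to
  precision \<open>n\<close> gives \<open>y\<close> to precision \<open>n + 1\<close>. Finitely many
  residue classes give finitely many centres.\<close>

lemma int_ring_finite_cover:
  assumes p: "uniformizer (p::'a::nonarch_local_field)"
  shows "\<exists>k. finite k \<and> int_ring \<subseteq> (\<Union>x\<in>k. {y::'a. absv (y - x) \<le> absv p ^ n})"
proof (induction n)
  case 0
  have "int_ring \<subseteq> (\<Union>x\<in>{0::'a}. {y. absv (y - x) \<le> absv p ^ 0})"
    by (auto simp: int_ring_def)
  then show ?case
    by (metis finite.intros)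
next
  case (Suc n)
  then obtain k where k: "finite k" "int_ring \<subseteq> (\<Union>x\<in>k. {y::'a. absv (y - x) \<le> absv p ^ n})"
    by blast
  define r where "r C = (SOME x. x \<in> C)" for C :: "'a set"
  define R where "R = r ` residue_field"
  have "finite R"
    by (simp add: R_def finite_residue_field)
  have "\<exists>z\<in>(\<lambda>(a, x). a + p * x) ` (R \<times> k). absv (y - z) \<le> absv p ^ Suc n" if "y \<in> int_ring" for y
  proof -
    define C where "C = {x. x \<in> int_ring \<and> absv (y - x) < 1}"
    have "C \<in> residue_field"
      using that by (auto simp: residue_field_def quotient_def C_def)
    have "y \<in> C"
      using that by (simp add: C_def)
    then have "r C \<in> C"
      unfolding r_def by (rule someI)
    then have "absv (y - r C) < 1"
      by (simp add: C_def)
    then obtain w where w: "y - r C = p * w" "w \<in> int_ring"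
      using p by (force simp: uniformizer_def)
    then obtain x where x: "x \<in> k" "absv (w - x) \<le> absv p ^ n"
      using k by auto
    have "y - (r C + p * x) = p * (w - x)"
      using w by (simp add: algebra_simps)
    then have "absv (y - (r C + p * x)) \<le> absv p ^ Suc n"
      using x by (simp add: absv_mult mult_left_mono)
    then show ?thesis
      using x \<open>C \<in> residue_field\<close> by (auto simp: R_def)
  qed
  then show ?case
    using \<open>finite R\<close> \<open>finite k\<close>
    by (intro exI[of _ "(\<lambda>(a, x). a + p * x) ` (R \<times> k)"]) blast
qed

lemma compact_int_ring: "compact (int_ring :: 'a::nonarch_local_field set)"
  unfolding compact_eq_totally_bounded
proof (intro conjI allI impI)
  show "complete (int_ring :: 'a set)"
    by (simp add: closed_int_ring complete_eq_closed)
  fix e :: real assume "e > 0"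
  obtain p :: 'a where p: "uniformizer p"
    using ex_normalized_uniformizer by blast
  then obtain n where "absv p ^ n < e"
    using real_arch_pow_inv[OF \<open>e > 0\<close>] uniformizer_absv_less_1 by blast
  obtain k where k: "finite k" "int_ring \<subseteq> (\<Union>x\<in>k. {y::'a. absv (y - x) \<le> absv p ^ n})"
    using int_ring_finite_cover[OF p] by blast
  have "{y. absv (y - x) \<le> absv p ^ n} \<subseteq> ball x e" for x :: 'a
    using \<open>absv p ^ n < e\<close> by (auto simp: dist_commute dist_absv[symmetric])
  then have "int_ring \<subseteq> (\<Union>x\<in>k. ball x e)"
    using k(2) by blast
  then show "\<exists>k. finite k \<and> int_ring \<subseteq> (\<Union>x\<in>k. ball (x::'a) e)"
    using k(1) by blast
qed

section \<open>Locally constant functions\<close>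

text \<open>\<open>locally\<close> asks for arbitrarily small neighbourhoods of constancy. Constancy
  passes to subsets, so one neighbourhood per point suffices.\<close>

lemma locally_constant_on_iff:
  "locally_constant_on S f \<longleftrightarrow> (\<forall>x\<in>S. \<exists>V. open V \<and> x \<in> V \<and> (\<forall>y\<in>V \<inter> S. f y = f x))"
proof
  assume L: "locally_constant_on S f"
  show "\<forall>x\<in>S. \<exists>V. open V \<and> x \<in> V \<and> (\<forall>y\<in>V \<inter> S. f y = f x)"
  proof
    fix x assume "x \<in> S"
    then obtain U V where "openin (top_of_set S) U" "f constant_on V" "x \<in> U" "U \<subseteq> V"
      using L unfolding locally_constant_on_def by (metis locallyE openin_subtopology_self)
    then obtain T where "open T" "U = S \<inter> T"
      by (auto simp: openin_open)
    then show "\<exists>V. open V \<and> x \<in> V \<and> (\<forall>y\<in>V \<inter> S. f y = f x)"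
      using \<open>x \<in> U\<close> \<open>U \<subseteq> V\<close> \<open>f constant_on V\<close>
      by (intro exI[of _ T]) (auto simp: constant_on_def subset_iff)
  qed
next
  assume R: "\<forall>x\<in>S. \<exists>V. open V \<and> x \<in> V \<and> (\<forall>y\<in>V \<inter> S. f y = f x)"
  show "locally_constant_on S f"
    unfolding locally_constant_on_def
  proof (rule locallyI)
    fix w x assume w: "openin (top_of_set S) w" "x \<in> w"
    then have "x \<in> S"
      using openin_imp_subset by blast
    then obtain V where V: "open V" "x \<in> V" "\<forall>y\<in>V \<inter> S. f y = f x"
      using R by blast
    have "openin (top_of_set S) (w \<inter> V)"
      using w V by (metis openin_Int_open)
    moreover have "f constant_on (w \<inter> V)"
      using V w openin_imp_subset[OF w(1)] by (auto simp: constant_on_def)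
    ultimately show "\<exists>U V. openin (top_of_set S) U \<and> f constant_on V \<and> x \<in> U \<and> U \<subseteq> V \<and> V \<subseteq> w"
      using V w by blast
  qed
qed

lemma locally_constant_on_subset:
  assumes "locally_constant_on T f" "S \<subseteq> T"
  shows "locally_constant_on S f"
  unfolding locally_constant_on_iff
proof
  fix x assume "x \<in> S"
  then obtain V where "open V" "x \<in> V" "\<forall>y\<in>V \<inter> T. f y = f x"
    using assms unfolding locally_constant_on_iff by (metis subsetD)
  then show "\<exists>V. open V \<and> x \<in> V \<and> (\<forall>y\<in>V \<inter> S. f y = f x)"
    using assms(2) by (intro exI[of _ V]) auto
qed

lemma locally_constant_on_cong:
  "(\<And>x. x \<in> S \<Longrightarrow> f x = g x) \<Longrightarrow> locally_constant_on S f \<longleftrightarrow> locally_constant_on S g"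
  unfolding locally_constant_on_iff
  by (intro ball_cong ex_cong1 conj_cong refl) auto

lemma locally_constant_on_compose:
  assumes "locally_constant_on T f" "continuous_on S g" "g ` S \<subseteq> T"
  shows "locally_constant_on S (\<lambda>x. f (g x))"
  unfolding locally_constant_on_iff
proof
  fix x assume x: "x \<in> S"
  then obtain V where V: "open V" "g x \<in> V" "\<forall>y\<in>V \<inter> T. f y = f (g x)"
    using assms unfolding locally_constant_on_iff by blast
  obtain U where "open U" "x \<in> U" "\<forall>y\<in>S. y \<in> U \<longrightarrow> g y \<in> V"
    using assms(2) V x unfolding continuous_on_topological by blast
  then show "\<exists>U. open U \<and> x \<in> U \<and> (\<forall>y\<in>U \<inter> S. f (g y) = f (g x))"
    using V assms(3) by (intro exI[of _ U]) auto
qed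

lemma locally_constant_on_combine:
  assumes "locally_constant_on S f" "locally_constant_on S g"
  shows "locally_constant_on S (\<lambda>x. h (f x) (g x))"
  unfolding locally_constant_on_iff
proof
  fix x assume "x \<in> S"
  then obtain U V where "open U" "x \<in> U" "\<forall>y\<in>U \<inter> S. f y = f x"
      "open V" "x \<in> V" "\<forall>y\<in>V \<inter> S. g y = g x"
    using assms unfolding locally_constant_on_iff by meson
  then show "\<exists>U. open U \<and> x \<in> U \<and> (\<forall>y\<in>U \<inter> S. h (f y) (g y) = h (f x) (g x))"
    by (intro exI[of _ "U \<inter> V"]) auto
qed

lemma continuous_on_locally_constant:
  assumes "locally_constant_on S f"
  shows "continuous_on S f"
  unfolding continuous_on_topological
  using assms unfolding locally_constant_on_iff by (metis IntI)

section \<open>Two by two matrices\<close>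

lemma mat2_nth [simp]:
  "mat2 a b c d $ 1 $ 1 = a" "mat2 a b c d $ 1 $ 2 = b"
  "mat2 a b c d $ 2 $ 1 = c" "mat2 a b c d $ 2 $ 2 = d"
  by (simp_all add: mat2_def)

lemma mat2_eta: "A = mat2 (A $ 1 $ 1) (A $ 1 $ 2) (A $ 2 $ 1) (A $ 2 $ 2)"
  by (simp add: vec_eq_iff forall_2)

lemma mat2_eq_iff [simp]:
  "mat2 a b c d = mat2 a' b' c' d' \<longleftrightarrow> a = a' \<and> b = b' \<and> c = c' \<and> d = d'"
  by (metis mat2_nth)

lemma mat2_mult [simp]:
  "mat2 a b c d ** mat2 a' b' c' d' =
     mat2 (a * a' + b * c') (a * b' + b * d') (c * a' + d * c') (c * b' + d * (d' :: 'a :: semiring_1))"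
  by (simp add: vec_eq_iff forall_2 matrix_matrix_mult_def sum_2)

lemma det_mat2 [simp]: "det (mat2 a b c d) = a * d - b * (c :: 'a :: comm_ring_1)"
  by (simp add: det_2)

lemma mat_1_eq_mat2: "(mat 1 :: 'a :: {zero,one} mat2) = mat2 1 0 0 1"
  by (simp add: vec_eq_iff forall_2 mat_def)

lemma matrix_mult_nth_2: "(A ** B) $ i $ j = A $ i $ 1 * B $ 1 $ j + A $ i $ 2 * (B :: 'a :: semiring_1 mat2) $ 2 $ j"
  by (simp add: matrix_matrix_mult_def sum_2)

lemma continuous_on_mat2 [continuous_intros]:
  fixes a :: "'b::topological_space \<Rightarrow> 'a::nonarch_local_field"
  assumes "continuous_on S a" "continuous_on S b" "continuous_on S c" "continuous_on S d"
  shows "continuous_on S (\<lambda>x. mat2 (a x) (b x) (c x) (d x))"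
proof -
  have "mat2 (a x) (b x) (c x) (d x) =
      (\<chi> i j. if i = 1 then if j = 1 then a x else b x else if j = 1 then c x else d x)" for x
    by (simp add: vec_eq_iff forall_2)
  moreover have "continuous_on S
      (\<lambda>x. \<chi> i j. if i = (1::2) then if j = (1::2) then a x else b x else if j = 1 then c x else d x)"
  proof (intro continuous_on_vec_lambda)
    fix i j :: 2
    show "continuous_on S (\<lambda>x. if i = 1 then if j = 1 then a x else b x
        else if j = 1 then c x else d x)"
      using assms by (cases "i = 1"; cases "j = 1") simp_all
  qed
  ultimately show ?thesis
    by simp
qed

lemma continuous_on_matrix_mult [continuous_intros]:
  fixes f g :: "'b::topological_space \<Rightarrow> 'a::nonarch_local_field mat2"
  assumes "continuous_on S f" "continuous_on S g"
  shows "continuous_on S (\<lambda>x. f x ** g x)"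
proof -
  have "f x ** g x = mat2 ((f x ** g x) $ 1 $ 1) ((f x ** g x) $ 1 $ 2)
      ((f x ** g x) $ 2 $ 1) ((f x ** g x) $ 2 $ 2)" for x
    by (rule mat2_eta)
  moreover have "continuous_on S (\<lambda>x. mat2 ((f x ** g x) $ 1 $ 1) ((f x ** g x) $ 1 $ 2)
      ((f x ** g x) $ 2 $ 1) ((f x ** g x) $ 2 $ 2))"
    unfolding matrix_mult_nth_2 using assms by (intro continuous_intros)
  ultimately show ?thesis
    by simp
qed

section \<open>The groups \<open>G2\<close>, \<open>B2\<close>, \<open>T2\<close> and
  \<open>K2\<close> in terms of matrix entries\<close>

lemma G2_iff: "g \<in> G2 \<longleftrightarrow> det g \<noteq> 0"
  by (simp add: G2_def invertible_det_nz)

lemma B2_iff: "b \<in> B2 \<longleftrightarrow> b $ 1 $ 1 \<noteq> 0 \<and> b $ 2 $ 2 \<noteq> 0 \<and> b $ 2 $ 1 = 0"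
  by (auto simp: B2_def G2_iff det_2)

lemma T2_iff: "t \<in> T2 \<longleftrightarrow> t $ 1 $ 1 \<noteq> 0 \<and> t $ 2 $ 2 \<noteq> 0 \<and> t $ 1 $ 2 = 0 \<and> t $ 2 $ 1 = 0"
  by (auto simp: T2_def G2_iff det_2)

lemma absv_sum_of_products_le_1:
  fixes a b c d :: "'a::nonarch_local_field"
  assumes "absv a \<le> 1" "absv b \<le> 1" "absv c \<le> 1" "absv d \<le> 1"
  shows "absv (a * b + c * d) \<le> 1" "absv (a * b - c * d) \<le> 1"
proof -
  have "absv (a * b) \<le> 1" "absv (c * d) \<le> 1"
    using assms by (auto simp: absv_mult mult_le_one)
  then show "absv (a * b + c * d) \<le> 1" "absv (a * b - c * d) \<le> 1"
    using absv_ultrametric[of "a * b" "c * d"] absv_diff_le[of "a * b" "c * d"] by auto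
qed

text \<open>If a matrix and its inverse are integral, both determinants are integral with product 1,
  hence units. Conversely the adjugate divided by a unit determinant is an integral inverse.\<close>

lemma K2_iff:
  fixes k :: "'a::nonarch_local_field mat2"
  shows "k \<in> K2 \<longleftrightarrow> (\<forall>i j. absv (k $ i $ j) \<le> 1) \<and> absv (det k) = 1"
proof
  assume "k \<in> K2"
  then obtain h :: "'a mat2"
    where h: "\<forall>i j. absv (k $ i $ j) \<le> 1" "\<forall>i j. absv (h $ i $ j) \<le> 1" "k ** h = mat 1"
    by (auto simp: K2_def int_ring_def)
  then have "absv (det k) \<le> 1" "absv (det h) \<le> 1"
    by (auto simp: det_2 intro!: absv_sum_of_products_le_1)
  moreover have "absv (det k) * absv (det h) = 1"
    using h by (simp flip: absv_mult det_mul)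
  ultimately have "absv (det k) = 1"
    by (metis absv_nonneg antisym mult.commute mult_left_le)
  then show "(\<forall>i j. absv (k $ i $ j) \<le> 1) \<and> absv (det k) = 1"
    using h by blast
next
  assume k: "(\<forall>i j. absv (k $ i $ j) \<le> 1) \<and> absv (det k) = 1"
  define D where "D = det k"
  define a where "a = k $ 1 $ 1"
  define b where "b = k $ 1 $ 2"
  define c where "c = k $ 2 $ 1"
  define d where "d = k $ 2 $ 2"
  have k_eq: "k = mat2 a b c d"
    unfolding a_def b_def c_def d_def by (rule mat2_eta)
  have D: "D = a * d - b * c" "absv D = 1" "D \<noteq> 0"
    using k by (auto simp: D_def k_eq)
  define h where "h = mat2 (d / D) (- b / D) (- c / D) (a / D)"
  have "\<forall>i j. absv (h $ i $ j) \<le> 1"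
    using k D by (simp add: h_def forall_2 absv_divide a_def b_def c_def d_def)
  moreover have "k ** h = mat 1" "h ** k = mat 1"
    using D(3) by (auto simp: k_eq h_def mat_1_eq_mat2 field_simps)
      (simp_all add: D(1) algebra_simps)
  ultimately show "k \<in> K2"
    using k unfolding K2_def int_ring_def by blast
qed

lemma K2_subset_G2: "K2 \<subseteq> (G2 :: 'a::nonarch_local_field mat2 set)"
  by (auto simp: K2_iff G2_iff)

lemma B2_subset_G2: "B2 \<subseteq> (G2 :: 'a::nonarch_local_field mat2 set)"
  by (auto simp: B2_def)

lemma G2_mult: "g \<in> G2 \<Longrightarrow> h \<in> G2 \<Longrightarrow> g ** h \<in> G2"
  by (simp add: G2_iff det_mul)

lemma G2_mult_iff_right: "h \<in> G2 \<Longrightarrow> g ** h \<in> G2 \<longleftrightarrow> g \<in> G2"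
  by (simp add: G2_iff det_mul)

lemma K2_mult: "g \<in> K2 \<Longrightarrow> h \<in> K2 \<Longrightarrow> g ** h \<in> K2"
  by (simp add: K2_iff det_mul absv_mult matrix_mult_nth_2 absv_sum_of_products_le_1)

lemma B2_mult: "g \<in> B2 \<Longrightarrow> h \<in> B2 \<Longrightarrow> g ** h \<in> B2"
  by (auto simp: B2_iff matrix_mult_nth_2)

lemma matrix_inv_G2:
  assumes "g \<in> G2"
  shows "matrix_inv g ** g = mat 1" "g ** matrix_inv g = mat 1" "matrix_inv g \<in> G2"
proof -
  show *: "matrix_inv g ** g = mat 1" "g ** matrix_inv g = mat 1"
    using assms someI_ex[of "\<lambda>h. g ** h = mat 1 \<and> h ** g = mat 1"]
    by (auto simp: G2_def invertible_def matrix_inv_def)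
  then have "det (matrix_inv g) * det g = 1"
    by (simp flip: det_mul)
  then show "matrix_inv g \<in> G2"
    by (auto simp: G2_iff)
qed

lemma K2_inv:
  fixes k :: "'a::nonarch_local_field mat2"
  assumes "k \<in> K2"
  shows "matrix_inv k \<in> K2"
proof -
  obtain h :: "'a mat2" where h: "\<forall>i j. h $ i $ j \<in> int_ring" "k ** h = mat 1" "h ** k = mat 1"
    using assms by (auto simp: K2_def)
  then have "h \<in> K2"
    using assms by (auto simp: K2_def)
  moreover have "matrix_inv k = h"
    using h assms K2_subset_G2 matrix_inv_G2(1)[of k]
    by (metis matrix_mul_assoc matrix_mul_lid matrix_mul_rid subsetD)
  ultimately show ?thesis by simp
qed

lemma B2_inv:
  assumes "b \<in> B2"
  shows "matrix_inv b \<in> B2"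
proof -
  define c where "c = matrix_inv b"
  have c: "c ** b = mat 1" "c \<in> G2"
    using matrix_inv_G2[of b] assms B2_subset_G2 by (auto simp: c_def)
  then have "(c ** b) $ 2 $ 1 = 0"
    by (simp add: mat_def)
  then have "c $ 2 $ 1 = 0"
    using assms by (simp add: matrix_mult_nth_2 B2_iff)
  then show ?thesis
    using c by (simp add: B2_def c_def)
qed

text \<open>Openness allows local constancy on \<open>K2\<close> to be carried over to
  neighbourhoods in \<open>G2\<close> when functions are extended.\<close>

lemma open_K2: "open (K2 :: 'a::nonarch_local_field mat2 set)"
proof -
  have "K2 = (\<Inter>i. \<Inter>j. (\<lambda>k::'a mat2. k $ i $ j) -` int_ring) \<inter> det -` {x. absv x = 1}"
    by (auto simp: K2_iff int_ring_def)
  moreover have "open (\<Inter>i. \<Inter>j. (\<lambda>k::'a mat2. k $ i $ j) -` int_ring)"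
    by (intro open_INT ballI finite open_vimage open_int_ring continuous_intros continuous_on_id)
  moreover have "open (det -` {x::'a. absv x = 1} :: 'a mat2 set)"
    unfolding det_2[abs_def]
    by (intro open_vimage open_absv_eq continuous_intros continuous_on_id) auto
  ultimately show ?thesis
    by (metis open_Int)
qed

text \<open>Divided by its larger entry, the lower row of \<open>g\<close> becomes the lower row of a matrix in \<open>K2\<close>.\<close>

lemma iwasawa_decomposition:
  fixes g :: "'a::nonarch_local_field mat2"
  assumes "g \<in> G2"
  obtains b k where "b \<in> B2" "k \<in> K2" "g = b ** k"
proof -
  define \<alpha> where "\<alpha> = g $ 1 $ 1"
  define \<beta> where "\<beta> = g $ 1 $ 2"
  define c where "c = g $ 2 $ 1"
  define d where "d = g $ 2 $ 2"
  have g: "g = mat2 \<alpha> \<beta> c d"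
    unfolding \<alpha>_def \<beta>_def c_def d_def by (rule mat2_eta)
  have D: "\<alpha> * d - \<beta> * c \<noteq> 0"
    using assms by (simp add: G2_iff g)
  show ?thesis
  proof (cases "absv c \<le> absv d")
    case True
    then have "d \<noteq> 0"
      using D by (metis absv_0 absv_eq_0_iff absv_nonneg antisym diff_zero mult_zero_right)
    then have "absv (c / d) \<le> 1"
      using True by (simp add: absv_divide)
    then show ?thesis
      using \<open>d \<noteq> 0\<close> D
      by (intro that[of "mat2 (\<alpha> - \<beta> * c / d) \<beta> 0 d" "mat2 1 0 (c / d) 1"])
        (auto simp: g B2_iff K2_iff forall_2 field_simps)
  next
    case False
    then have "c \<noteq> 0"
      by auto
    then have "absv (d / c) \<le> 1"
      using False by (simp add: absv_divide)
    then show ?thesis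
      using \<open>c \<noteq> 0\<close> D
      by (intro that[of "mat2 (\<beta> - \<alpha> * d / c) \<alpha> 0 c" "mat2 0 1 1 (d / c)"])
        (auto simp: g B2_iff K2_iff forall_2 field_simps)
  qed
qed

section \<open>Unramified characters and induced functions\<close>

lemma unramified_mult: "unramified \<eta> \<Longrightarrow> x \<noteq> 0 \<Longrightarrow> y \<noteq> 0 \<Longrightarrow> \<eta> (x * y) = \<eta> x * \<eta> y"
  by (simp add: unramified_def quasicharacter_def)

lemma unramified_nonzero: "unramified \<eta> \<Longrightarrow> x \<noteq> 0 \<Longrightarrow> \<eta> x \<noteq> 0"
  by (simp add: unramified_def quasicharacter_def)

lemma unramified_unit: "unramified \<eta> \<Longrightarrow> absv x = 1 \<Longrightarrow> \<eta> x = 1"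
  by (simp add: unramified_def)

lemma unramified_inverse:
  assumes "unramified \<eta>" "x \<noteq> 0"
  shows "\<eta> (inverse x) = inverse (\<eta> x)"
proof -
  have "\<eta> x * \<eta> (inverse x) = 1"
    using assms by (simp flip: unramified_mult add: unramified_unit)
  then show ?thesis
    by (metis inverse_unique)
qed

lemma unramified_power:
  assumes "unramified \<eta>" "x \<noteq> 0"
  shows "\<eta> (x ^ n) = \<eta> x ^ n"
  using assms by (induction n) (auto simp: unramified_mult unramified_unit)

lemma unramified_powi:
  assumes "unramified \<eta>" "x \<noteq> 0"
  shows "\<eta> (x powi n) = \<eta> x powi n"
  using assms by (auto simp: power_int_def unramified_power unramified_inverse)

text \<open>Write \<open>a\<close> as a unit times \<open>p powi val a\<close>; the unit does not
  contribute.\<close>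

lemma unramified_eq_powi:
  assumes "unramified \<eta>" "uniformizer p" "a \<noteq> 0"
  shows "\<eta> a = \<eta> p powi val a"
proof -
  have p: "p \<noteq> 0"
    using assms uniformizer_nonzero by blast
  then have "val (a / p powi val a) = 0"
    using assms by (simp add: val_divide val_powi val_uniformizer)
  then have "absv (a / p powi val a) = 1"
    using assms p by (subst absv_eq_1_iff_val) auto
  then have "\<eta> (a / p powi val a) = 1"
    using assms by (simp add: unramified_unit)
  moreover have "a = (a / p powi val a) * p powi val a"
    using p by simp
  ultimately show ?thesis
    using assms p by (metis divide_eq_0_iff mult_1 power_int_eq_0_iff unramified_mult unramified_powi)
qed

lemma unramified_powi_val:
  assumes "\<gamma> \<noteq> 0"
  shows "unramified (\<lambda>a::'a::nonarch_local_field. \<gamma> powi val a)"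
proof -
  have "locally_constant_on (- {0::'a}) (\<lambda>a. \<gamma> powi val a)"
    unfolding locally_constant_on_iff
  proof
    fix x :: 'a assume "x \<in> - {0}"
    then show "\<exists>V. open V \<and> x \<in> V \<and> (\<forall>y\<in>V \<inter> - {0}. \<gamma> powi val y = \<gamma> powi val x)"
      using open_val[of "\<lambda>n. n = val x"] by (intro exI[of _ "{a. a \<noteq> 0 \<and> val a = val x}"]) auto
  qed
  moreover have "val u = 0" if "absv u = 1" for u :: 'a
    using that by (intro val_eqI) simp
  ultimately show ?thesis
    using assms
    by (auto simp: unramified_def quasicharacter_def continuous_on_locally_constant val_mult
        power_int_add)
qed

text \<open>\<open>W_continuation\<close> constrains the value at \<open>z\<close> only through
  characters with parameters \<open>z\<close>. Their existence makes that constraint effective in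
  the uniqueness proof.\<close>

lemma ex_has_parameters:
  assumes "uniformizer p" "z \<in> Lambda_domain q"
  shows "\<exists>\<xi>1 \<xi>2 \<sigma>. has_parameters p \<xi>1 \<xi>2 \<sigma> z"
proof -
  obtain \<gamma>1 \<gamma>2 \<tau> where "z = (\<gamma>1, \<gamma>2, \<tau>)" "\<gamma>1 \<noteq> 0" "\<gamma>2 \<noteq> 0" "\<tau> \<noteq> 0"
    using assms(2) by (auto simp: Lambda_domain_def)
  then have "has_parameters p (\<lambda>a. \<gamma>1 powi val a) (\<lambda>a. \<gamma>2 powi val a) (\<lambda>a. \<tau> powi val a) z"
    using assms(1) by (simp add: has_parameters_def unramified_powi_val val_uniformizer)
  then show ?thesis
    by blast
qed

section \<open>The inducing character, induced functions and their restriction to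
  \<open>K2\<close>\<close>

definition borel_char ::
    "('a::nonarch_local_field \<Rightarrow> complex) \<Rightarrow> ('a \<Rightarrow> complex) \<Rightarrow> 'a mat2 \<Rightarrow> complex" where
  "borel_char \<xi>1 \<xi>2 b = \<xi>1 (b $ 1 $ 1) * \<xi>2 (b $ 2 $ 2) * complex_of_real (sqrt (modular_B2 b))"

lemma borel_char_mult:
  assumes "unramified \<xi>1" "unramified \<xi>2" "b \<in> B2" "c \<in> B2"
  shows "borel_char \<xi>1 \<xi>2 (b ** c) = borel_char \<xi>1 \<xi>2 b * borel_char \<xi>1 \<xi>2 c"
  using assms
  by (simp add: borel_char_def B2_iff matrix_mult_nth_2 unramified_mult modular_B2_def absv_mult
      absv_divide real_sqrt_mult real_sqrt_divide)

text \<open>The diagonal entries are integral and their product is a unit, so both are units, on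
  which unramified characters and the modulus are trivial. This is what makes restrictions to
  \<open>K2\<close> left invariant and extensions from \<open>K2\<close> well defined.\<close>

lemma borel_char_K2:
  assumes "unramified \<xi>1" "unramified \<xi>2" "b \<in> B2 \<inter> K2"
  shows "borel_char \<xi>1 \<xi>2 b = 1"
proof -
  have "absv (b $ 1 $ 1) * absv (b $ 2 $ 2) = 1" "absv (b $ 1 $ 1) \<le> 1" "absv (b $ 2 $ 2) \<le> 1"
    using assms(3) by (auto simp: K2_iff B2_iff det_2 absv_mult)
  then have "absv (b $ 1 $ 1) = 1" "absv (b $ 2 $ 2) = 1"
    using mult_left_le[of "absv (b $ 1 $ 1)" "absv (b $ 2 $ 2)"]
      mult_left_le[of "absv (b $ 2 $ 2)" "absv (b $ 1 $ 1)"]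
    by (simp_all add: mult.commute)
  then show ?thesis
    using assms by (simp add: borel_char_def modular_B2_def unramified_unit absv_divide)
qed

lemma Ind_borel_mult:
  assumes "\<phi> \<in> Ind \<xi>1 \<xi>2" "b \<in> B2" "g \<in> G2"
  shows "\<phi> (b ** g) = borel_char \<xi>1 \<xi>2 b * \<phi> g"
  using assms by (simp add: Ind_def borel_char_def)

lemma Ind_add: "u \<in> Ind \<xi>1 \<xi>2 \<Longrightarrow> v \<in> Ind \<xi>1 \<xi>2 \<Longrightarrow> (\<lambda>g. u g + v g) \<in> Ind \<xi>1 \<xi>2"
  using locally_constant_on_combine[of G2 u v "(+)"] by (simp add: Ind_def algebra_simps)

lemma Ind_scale: "v \<in> Ind \<xi>1 \<xi>2 \<Longrightarrow> (\<lambda>g. c * v g) \<in> Ind \<xi>1 \<xi>2"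
  using locally_constant_on_combine[of G2 v v "\<lambda>x _. c * x"]
  by (simp add: Ind_def mult.left_commute)

lemma Ind_right_translate:
  assumes "v \<in> Ind \<xi>1 \<xi>2" "h \<in> G2"
  shows "right_translate h v \<in> Ind \<xi>1 \<xi>2"
proof -
  have lc: "locally_constant_on G2 (\<lambda>g. v (g ** h))"
  proof (rule locally_constant_on_compose[of G2 v G2 "\<lambda>g. g ** h"])
    show "locally_constant_on G2 v"
      using assms by (simp add: Ind_def)
    show "continuous_on G2 (\<lambda>g. g ** h)"
      by (rule continuous_on_matrix_mult[OF continuous_on_id continuous_on_const])
    show "(\<lambda>g. g ** h) ` G2 \<subseteq> G2"
      using assms by (auto simp: G2_mult)
  qed
  have "v (b ** g ** h) = borel_char \<xi>1 \<xi>2 b * v (g ** h)" if "b \<in> B2" "g \<in> G2" for b g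
    using that assms by (simp only: matrix_mul_assoc[symmetric] Ind_borel_mult G2_mult)
  moreover have "v (g ** h) = 0" if "g \<notin> G2" for g
    using that assms by (simp add: Ind_def G2_mult_iff_right)
  ultimately show ?thesis
    using lc by (simp add: Ind_def right_translate_def borel_char_def)
qed

lemma restrict_K2_in_Cinf_K2:
  assumes "\<phi> \<in> Ind \<xi>1 \<xi>2" "unramified \<xi>1" "unramified \<xi>2"
  shows "restrict_K2 \<phi> \<in> Cinf_K2"
proof -
  have "locally_constant_on K2 \<phi>"
    using assms K2_subset_G2 by (auto simp: Ind_def intro: locally_constant_on_subset)
  then have "locally_constant_on K2 (restrict_K2 \<phi>)"
    by (subst locally_constant_on_cong[of _ _ \<phi>]) (auto simp: restrict_K2_def)
  moreover have "\<phi> (b ** k) = \<phi> k" if "b \<in> B2 \<inter> K2" "k \<in> K2" for b k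
    using that Ind_borel_mult[OF assms(1), of b k] borel_char_K2[OF assms(2,3)] K2_subset_G2 by auto
  ultimately show ?thesis
    by (auto simp: Cinf_K2_def restrict_K2_def K2_mult)
qed

lemma Ind_extension_restrict_K2: "\<phi> \<in> Ind \<xi>1 \<xi>2 \<Longrightarrow> Ind_extension \<xi>1 \<xi>2 (restrict_K2 \<phi>) \<phi>"
  by (simp add: Ind_extension_def restrict_K2_def)

lemma Ind_extension_unique:
  assumes "Ind_extension \<xi>1 \<xi>2 f \<phi>" "Ind_extension \<xi>1 \<xi>2 f \<psi>"
  shows "\<phi> = \<psi>"
proof
  fix g
  show "\<phi> g = \<psi> g"
  proof (cases "g \<in> G2")
    case True
    then obtain b k where "b \<in> B2" "k \<in> K2" "g = b ** k"
      by (rule iwasawa_decomposition)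
    then show ?thesis
      using assms K2_subset_G2 by (auto simp: Ind_extension_def Ind_borel_mult subset_iff)
  next
    case False
    then show ?thesis
      using assms by (simp add: Ind_extension_def Ind_def)
  qed
qed

text \<open>The extension sends \<open>b ** k\<close> to the inducing character at \<open>b\<close>
  times \<open>f k\<close>. The work lies in its independence of the decomposition and in its local
  constancy away from \<open>K2\<close>.\<close>

lemma ex_Ind_extension:
  fixes f :: "'a::nonarch_local_field mat2 \<Rightarrow> complex"
  assumes f: "f \<in> Cinf_K2" and unr: "unramified \<xi>1" "unramified \<xi>2"
  shows "\<exists>\<phi>. Ind_extension \<xi>1 \<xi>2 f \<phi>"
proof -
  define \<omega> where "\<omega> = borel_char \<xi>1 \<xi>2"
  define dec where "dec g bk \<longleftrightarrow> fst bk \<in> B2 \<and> snd bk \<in> K2 \<and> g = fst bk ** snd bk" for g :: "'a mat2" and bk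
  define \<phi> where "\<phi> g = (if g \<in> G2 then let bk = (SOME bk. dec g bk) in \<omega> (fst bk) * f (snd bk) else 0)" for g
  have wd: "\<omega> b * f k = \<omega> b' * f k'"
    if "b \<in> B2" "k \<in> K2" "b' \<in> B2" "k' \<in> K2" "b ** k = b' ** k'" for b k b' k'
  proof -
    \<comment> \<open>\<open>c\<close> measures the ambiguity of the decomposition. It is upper
      triangular and also equals \<open>k' ** matrix_inv k\<close>, so it lies in
      \<open>B2 \<inter> K2\<close>, where \<open>\<omega>\<close> is 1 and under which
      \<open>f\<close> is left invariant.\<close>
    define c where "c = matrix_inv b' ** b"
    have G: "b \<in> G2" "b' \<in> G2" "k \<in> G2" "k' \<in> G2"
      using that B2_subset_G2 K2_subset_G2 by auto
    have "c \<in> B2"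
      using that by (simp add: c_def B2_mult B2_inv)
    have "c ** k = matrix_inv b' ** (b' ** k')"
      using that by (simp add: c_def flip: matrix_mul_assoc)
    then have ck: "c ** k = k'"
      using G by (simp add: matrix_mul_assoc matrix_inv_G2)
    then have "c = k' ** matrix_inv k"
      using G by (metis matrix_mul_assoc matrix_inv_G2(2) matrix_mul_rid)
    then have "c \<in> B2 \<inter> K2"
      using \<open>c \<in> B2\<close> that by (simp add: K2_mult K2_inv)
    then have "f k' = f k"
      using f that by (auto simp: Cinf_K2_def simp flip: ck)
    moreover have "b = b' ** c"
      using G by (simp add: c_def matrix_mul_assoc matrix_inv_G2)
    then have "\<omega> b = \<omega> b'"
      using borel_char_mult[OF unr \<open>b' \<in> B2\<close> \<open>c \<in> B2\<close>] borel_char_K2[OF unr \<open>c \<in> B2 \<inter> K2\<close>]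
      by (simp add: \<omega>_def)
    ultimately show ?thesis
      by simp
  qed
  have \<phi>: "\<phi> (b ** k) = \<omega> b * f k" if "b \<in> B2" "k \<in> K2" for b k
  proof -
    define bk where "bk = (SOME bk. dec (b ** k) bk)"
    have "dec (b ** k) bk"
      unfolding bk_def by (rule someI[of _ "(b, k)"]) (use that in \<open>simp add: dec_def\<close>)
    then have "\<omega> (fst bk) * f (snd bk) = \<omega> b * f k"
      using that by (intro wd) (auto simp: dec_def)
    moreover have "b ** k \<in> G2"
      using that B2_subset_G2 K2_subset_G2 by (meson G2_mult subsetD)
    ultimately show ?thesis
      by (simp add: \<phi>_def flip: bk_def)
  qed
  have \<phi>_borel: "\<phi> (b ** g) = \<omega> b * \<phi> g" if bg: "b \<in> B2" "g \<in> G2" for b g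
  proof -
    obtain c k where "c \<in> B2" "k \<in> K2" "g = c ** k"
      using bg(2) by (rule iwasawa_decomposition)
    then show ?thesis
      using bg unr by (simp add: \<phi> matrix_mul_assoc B2_mult borel_char_mult \<omega>_def)
  qed
  have "mat 1 \<in> B2"
    by (simp add: mat_1_eq_mat2 B2_iff)
  moreover have "\<omega> (mat 1) = 1"
    unfolding \<omega>_def by (rule borel_char_K2[OF unr]) (simp add: mat_1_eq_mat2 B2_iff K2_iff forall_2)
  ultimately have \<phi>_K2: "\<phi> k = f k" if "k \<in> K2" for k
    using \<phi>[of "mat 1" k] that by simp
  have "locally_constant_on G2 \<phi>"
    unfolding locally_constant_on_iff
  proof
    fix g :: "'a mat2" assume "g \<in> G2"
    then obtain b k where bk: "b \<in> B2" "k \<in> K2" "g = b ** k"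
      by (rule iwasawa_decomposition)
    define c where "c = matrix_inv b"
    have bG: "b \<in> G2"
      using bk B2_subset_G2 by auto
    have cb: "c ** b = mat 1" "b ** c = mat 1"
      using matrix_inv_G2[OF bG] by (auto simp: c_def)
    have "locally_constant_on K2 f"
      using f by (simp add: Cinf_K2_def)
    then have "\<exists>V. open V \<and> k \<in> V \<and> (\<forall>y\<in>V \<inter> K2. f y = f k)"
      unfolding locally_constant_on_iff using bk(2) by (rule bspec)
    then obtain V where V: "open V" "k \<in> V" "\<forall>y\<in>V \<inter> K2. f y = f k"
      by (elim exE conjE)
    \<comment> \<open>As \<open>K2\<close> is open, every \<open>h\<close> near \<open>g\<close>
      decomposes with the same Borel part: \<open>h = b ** (c ** h)\<close> with
      \<open>c ** h\<close> in \<open>K2\<close> near \<open>k\<close>. Only the argument of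
      \<open>f\<close> moves, and \<open>f\<close> is constant there.\<close>
    define U where "U = (\<lambda>h. c ** h) -` (V \<inter> K2)"
    have "open U"
      unfolding U_def using V
      by (intro open_vimage open_Int open_K2
          continuous_on_matrix_mult[OF continuous_on_const continuous_on_id])
    moreover have "g \<in> U"
      using bk V cb by (simp add: U_def matrix_mul_assoc)
    moreover have "\<phi> h = \<phi> g" if "h \<in> U" for h
    proof -
      have ch: "c ** h \<in> V \<inter> K2"
        using that by (simp add: U_def)
      have "b ** (c ** h) = h"
        using cb by (simp add: matrix_mul_assoc)
      then have "\<phi> h = \<omega> b * f (c ** h)"
        using \<phi>[of b "c ** h"] bk(1) ch by simp
      also have "f (c ** h) = f k"
        using V(3) ch by (rule bspec)
      also have "\<omega> b * f k = \<phi> g"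
        unfolding bk(3) using \<phi>[OF bk(1,2)] by (rule sym)
      finally show ?thesis .
    qed
    ultimately show "\<exists>U. open U \<and> g \<in> U \<and> (\<forall>y\<in>U \<inter> G2. \<phi> y = \<phi> g)"
      by blast
  qed
  then have "\<phi> \<in> Ind \<xi>1 \<xi>2"
    using \<phi>_borel by (auto simp: Ind_def \<omega>_def borel_char_def \<phi>_def)
  then show ?thesis
    using \<phi>_K2 by (auto simp: Ind_extension_def)
qed

section \<open>The Haar measure of the multiplicative group\<close>

lemma mult_haar_measurable_continuous:
  assumes "mult_haar \<mu>" "continuous_on (- {0}) f"
  shows "f \<in> borel_measurable \<mu>"
proof -
  have "f \<in> borel_measurable (restrict_space borel (- {0}))"
    using assms(2) by (rule borel_measurable_continuous_on_restrict)
  moreover have "sets \<mu> = sets (restrict_space borel (- {0}))"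
    using assms(1) by (simp add: mult_haar_def)
  ultimately show ?thesis
    using measurable_cong_sets by blast
qed

lemma mult_haar_open_in_sets:
  assumes "mult_haar (\<mu> :: 'a::nonarch_local_field measure)" "open S" "0 \<notin> S"
  shows "S \<in> sets \<mu>"
proof -
  have "S \<in> sets (restrict_space borel (- {0}))"
    using assms by (subst sets_restrict_space_iff) auto
  then show ?thesis
    using assms(1) by (simp add: mult_haar_def)
qed

lemma measurable_val:
  assumes "mult_haar (\<mu> :: 'a::nonarch_local_field measure)"
  shows "val \<in> measurable \<mu> (count_space UNIV)"
proof -
  have "val -` {n} \<inter> space \<mu> \<in> sets \<mu>" for n
  proof -
    have "val -` {n} \<inter> space \<mu> = {a. a \<noteq> 0 \<and> val a = n}"
      using assms by (auto simp: mult_haar_def)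
    then show ?thesis
      using mult_haar_open_in_sets[OF assms open_val[of "\<lambda>m. m = n"]] by simp
  qed
  then show ?thesis
    by (simp add: measurable_count_space_eq2_countable)
qed

lemma mult_haar_measurable_mult:
  assumes "mult_haar (\<mu> :: 'a::nonarch_local_field measure)" "c \<noteq> 0"
  shows "(*) c \<in> measurable \<mu> \<mu>"
proof -
  have "(*) c \<in> borel_measurable \<mu>"
    by (rule mult_haar_measurable_continuous[OF assms(1)]) (intro continuous_intros)
  then have "(*) c \<in> measurable \<mu> (restrict_space borel (- {0}))"
    using assms by (intro measurable_restrict_space2) (auto simp: mult_haar_def)
  moreover have "sets \<mu> = sets (restrict_space borel (- {0}))"
    using assms(1) by (simp add: mult_haar_def)
  ultimately show ?thesis
    using measurable_cong_sets by blast
qed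

text \<open>Invariance is assumed for images of sets; the preimage under multiplication by
  \<open>c\<close> is the image under multiplication by \<open>inverse c\<close>.\<close>

lemma distr_mult_haar:
  assumes "mult_haar (\<mu> :: 'a::nonarch_local_field measure)" "c \<noteq> 0"
  shows "distr \<mu> \<mu> ((*) c) = \<mu>"
proof (rule measure_eqI)
  fix A assume A: "A \<in> sets (distr \<mu> \<mu> ((*) c))"
  then have "A \<subseteq> - {0}"
    using assms(1) sets.sets_into_space[of A \<mu>] by (simp add: mult_haar_def)
  then have "(*) c -` A \<inter> space \<mu> = (*) (inverse c) ` A"
    using assms by (auto simp: mult_haar_def image_iff field_simps intro!: bexI[of _ "c * _"])
  then have "emeasure (distr \<mu> \<mu> ((*) c)) A = emeasure \<mu> ((*) (inverse c) ` A)"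
    using A by (subst emeasure_distr[OF mult_haar_measurable_mult[OF assms]]) auto
  also have "\<dots> = emeasure \<mu> A"
    using assms A by (auto simp: mult_haar_def)
  finally show "emeasure (distr \<mu> \<mu> ((*) c)) A = emeasure \<mu> A" .
qed simp

lemma mult_haar_integral_mult:
  fixes g :: "'a::nonarch_local_field \<Rightarrow> complex"
  assumes "mult_haar \<mu>" "c \<noteq> 0" "g \<in> borel_measurable \<mu>"
  shows "(LINT a|\<mu>. g (c * a)) = (LINT a|\<mu>. g a)"
  using integral_distr[OF mult_haar_measurable_mult[OF assms(1,2)] assms(3)]
  by (simp add: distr_mult_haar assms)

lemma mult_haar_integrable_mult:
  fixes g :: "'a::nonarch_local_field \<Rightarrow> complex"
  assumes "mult_haar \<mu>" "c \<noteq> 0" "integrable \<mu> g"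
  shows "integrable \<mu> (\<lambda>a. g (c * a))"
  using integrable_distr_eq[OF mult_haar_measurable_mult[OF assms(1,2)], of g] assms
  by (simp add: distr_mult_haar)

text \<open>The annulus is the translate by \<open>p powi n\<close> of the units, which have mass 1
  by normalization.\<close>

lemma emeasure_mult_haar_val:
  assumes "mult_haar (\<mu> :: 'a::nonarch_local_field measure)"
  shows "emeasure \<mu> {a. a \<noteq> 0 \<and> val a = n} = 1"
proof -
  obtain p :: 'a where p: "uniformizer p"
    using ex_normalized_uniformizer by blast
  then have p0: "p powi n \<noteq> 0"
    using uniformizer_nonzero by auto
  have val_pn: "val (p powi n) = n"
    using p by (simp add: val_powi val_uniformizer uniformizer_nonzero)
  have "a \<in> (*) (p powi n) ` {u. absv u = 1}" if "a \<noteq> 0" "val a = n" for a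
  proof -
    have "absv (a / p powi n) = 1"
      using that p0 val_pn by (subst absv_eq_1_iff_val) (auto simp: val_divide)
    moreover have "a = p powi n * (a / p powi n)"
      using p0 by simp
    ultimately show ?thesis
      by blast
  qed
  moreover have "p powi n * u \<noteq> 0 \<and> val (p powi n * u) = n" if "absv u = 1" for u
  proof -
    have "u \<noteq> 0"
      using that by auto
    then show ?thesis
      using p0 val_pn that by (simp add: val_mult absv_eq_1_iff_val)
  qed
  ultimately have "{a. a \<noteq> 0 \<and> val a = n} = (*) (p powi n) ` {u. absv u = 1}"
    by auto
  moreover have "{u::'a. absv u = 1} \<in> sets \<mu>"
    by (rule mult_haar_open_in_sets[OF assms open_absv_eq]) auto
  ultimately show ?thesis
    using assms p0 by (simp add: mult_haar_def)
qed

text \<open>All annuli have mass 1, so integrals of functions of \<open>val\<close> become sums over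
  the integers.\<close>

lemma distr_val_mult_haar:
  assumes "mult_haar (\<mu> :: 'a::nonarch_local_field measure)"
  shows "distr \<mu> (count_space UNIV) val = count_space UNIV"
proof (rule measure_eqI_countable[where A = UNIV])
  fix n :: int
  have "val -` {n} \<inter> space \<mu> = {a. a \<noteq> 0 \<and> val a = n}"
    using assms by (auto simp: mult_haar_def)
  then show "emeasure (distr \<mu> (count_space UNIV) val) {n} = emeasure (count_space UNIV) {n}"
    using emeasure_mult_haar_val[OF assms] by (simp add: emeasure_distr[OF measurable_val[OF assms]])
qed auto

text \<open>Two geometric series, over the nonnegative and the nonpositive integers. The overlap at
  0 is harmless for summability over the union.\<close>

lemma integrable_power_abs_val:
  assumes "mult_haar (\<mu> :: 'a::nonarch_local_field measure)" "0 \<le> r" "r < (1::real)"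
  shows "integrable \<mu> (\<lambda>a. r ^ nat \<bar>val a\<bar>)"
proof -
  define g where "g n = r ^ nat \<bar>n\<bar>" for n :: int
  have "summable (\<lambda>n. norm (r ^ n))"
    using assms by (simp add: summable_geometric power_abs)
  then have "Infinite_Set_Sum.abs_summable_on (\<lambda>n. g (int n)) UNIV"
      "Infinite_Set_Sum.abs_summable_on (\<lambda>n. g (- int n)) UNIV"
    by (simp_all add: g_def Infinite_Set_Sum.abs_summable_on_nat_iff')
  moreover have "inj int" "inj (\<lambda>n. - int n)"
    by (auto simp: inj_on_def)
  ultimately have "Infinite_Set_Sum.abs_summable_on g (range int)"
      "Infinite_Set_Sum.abs_summable_on g (range (\<lambda>n. - int n))"
    using Infinite_Set_Sum.abs_summable_on_reindex_iff by blast+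
  then have "Infinite_Set_Sum.abs_summable_on g (range int \<union> range (\<lambda>n. - int n))"
    by (rule Infinite_Set_Sum.abs_summable_on_union)
  moreover have "range int \<union> range (\<lambda>n. - int n) = UNIV"
    by (auto simp: image_iff) (metis int_cases2)
  ultimately have "integrable (count_space UNIV) g"
    by (simp add: Infinite_Set_Sum.abs_summable_on_def)
  then show ?thesis
    using integrable_distr_eq[OF measurable_val[OF assms(1)], of g]
    by (simp add: distr_val_mult_haar[OF assms(1)] g_def)
qed

section \<open>The integrand of the Waldspurger functional\<close>

text \<open>The values at the maximal compact parts of the Iwasawa decompositions of the matrices
  with lower row \<open>(a, 1)\<close>.\<close>

definition profile :: "('a::nonarch_local_field mat2 \<Rightarrow> complex) \<Rightarrow> 'a \<Rightarrow> complex" where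
  "profile f a = (if absv a \<le> 1 then f (mat2 1 0 a 1) else f (mat2 0 1 1 (inverse a)))"

text \<open>Only nonnegative exponents occur, so for fixed \<open>n\<close> this is a polynomial in
  \<open>x\<close> and \<open>y\<close>. Both branches would give 1 at \<open>n = 0\<close>.\<close>

definition radial :: "complex \<Rightarrow> complex \<Rightarrow> int \<Rightarrow> complex" where
  "radial x y n = (if 0 \<le> n then x ^ nat n else y ^ nat (- n))"

text \<open>For fixed \<open>f\<close> on \<open>K2\<close> the parameters enter through the radial
  factor alone.\<close>

definition flat_integrand ::
    "complex \<Rightarrow> complex \<Rightarrow> ('a::nonarch_local_field mat2 \<Rightarrow> complex) \<Rightarrow> 'a \<Rightarrow> complex" where
  "flat_integrand x y f a = radial x y (val a) * profile f a"

lemma sqrt_residue_card_powi: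
  "sqrt (residue_card TYPE('a::nonarch_local_field) powi (- int n)) = (residue_card TYPE('a) powr (-1/2)) ^ n"
proof -
  have q: "residue_card TYPE('a) > 0"
    by (rule residue_card_pos)
  have "((residue_card TYPE('a) powr (-1/2)) ^ n)\<^sup>2 = ((residue_card TYPE('a) powr (-1/2))\<^sup>2) ^ n"
    by (simp add: power_mult[symmetric] mult.commute)
  also have "(residue_card TYPE('a) powr (-1/2))\<^sup>2 = residue_card TYPE('a) powr (- 1)"
    unfolding power2_eq_square powr_add[symmetric] by simp
  also have "\<dots> = inverse (residue_card TYPE('a))"
    using q by (simp add: powr_minus)
  finally show ?thesis
    by (intro real_sqrt_unique) (simp_all add: power_int_minus power_inverse)
qed

text \<open>The argument of \<open>\<phi>\<close> has lower row \<open>(a, 1)\<close>. Its Borel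
  part has diagonal \<open>(- a, 1)\<close> or \<open>(1, a)\<close>; the inducing character there,
  combined with the inverse of \<open>\<sigma> a\<close>, is a power of one fixed number in each
  case.\<close>

lemma W_integrand_eq_flat_integrand:
  fixes p :: "'a::nonarch_local_field"
  assumes unr: "unramified \<xi>1" "unramified \<xi>2" "unramified \<sigma>" and p: "uniformizer p"
    and \<phi>: "\<phi> \<in> Ind \<xi>1 \<xi>2" and f: "\<And>k. k \<in> K2 \<Longrightarrow> f k = \<phi> k" and a: "a \<noteq> 0"
  defines "s \<equiv> complex_of_real (residue_card TYPE('a) powr (-1/2))"
  shows "W_integrand \<sigma> \<phi> a =
    flat_integrand (\<xi>1 p * inverse (\<sigma> p) * s) (inverse (\<xi>2 p) * \<sigma> p * s) f a"
proof -
  have W: "W_integrand \<sigma> \<phi> a = \<phi> (mat2 0 1 a 1) * inverse (\<sigma> a)"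
    by (simp add: W_integrand_def)
  have nz: "\<xi>1 p \<noteq> 0" "\<xi>2 p \<noteq> 0" "\<sigma> p \<noteq> 0"
    using unr p by (auto simp: unramified_nonzero uniformizer_nonzero)
  have one: "\<xi>1 1 = 1" "\<xi>2 1 = 1"
    using unr by (simp_all add: unramified_unit)
  show ?thesis
  proof (cases "absv a \<le> 1")
    case True
    define n where "n = nat (val a)"
    have n: "val a = int n"
      using True a by (simp add: n_def absv_le_1_iff_val)
    \<comment> \<open>The Borel part below has \<open>- a\<close> on its diagonal; an unramified
      character does not see the sign.\<close>
    have "val (- a) = val a"
      using a by (intro val_eqI) (simp add: absv_val)
    then have \<xi>: "\<xi>1 (- a) = \<xi>1 p ^ n" "\<sigma> a = \<sigma> p ^ n"
      using a unr p n by (simp_all add: unramified_eq_powi[OF _ p])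
    have k: "mat2 1 0 a 1 \<in> K2"
      using True by (simp add: K2_iff forall_2)
    have "mat2 0 1 a 1 = mat2 (- a) 1 0 1 ** mat2 1 0 a 1"
      by simp
    then have "\<phi> (mat2 0 1 a 1) = borel_char \<xi>1 \<xi>2 (mat2 (- a) 1 0 1) * \<phi> (mat2 1 0 a 1)"
      using a k K2_subset_G2 \<phi> by (metis (no_types) Ind_borel_mult B2_iff mat2_nth neg_equal_0_iff_equal subsetD zero_neq_one)
    moreover have "borel_char \<xi>1 \<xi>2 (mat2 (- a) 1 0 1) = \<xi>1 p ^ n * s ^ n"
      using a n sqrt_residue_card_powi[where 'a='a, of n]
      by (simp add: borel_char_def modular_B2_def \<xi> one absv_val s_def)
    ultimately show ?thesis
      using True k f nz n \<xi>
      by (simp add: W flat_integrand_def radial_def profile_def power_mult_distrib power_inverse)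
  next
    case False
    define n where "n = nat (- val a)"
    have n: "val a = - int n" "n > 0"
      using False a by (simp_all add: n_def absv_le_1_iff_val)
    have \<xi>: "\<xi>2 a = inverse (\<xi>2 p) ^ n" "\<sigma> a = inverse (\<sigma> p) ^ n"
      using a unr p n by (simp_all add: unramified_eq_powi[OF _ p] power_int_minus power_inverse)
    have k: "mat2 0 1 1 (inverse a) \<in> K2"
      using False by (simp add: K2_iff forall_2 absv_inverse inverse_le_1_iff)
    have "mat2 0 1 a 1 = mat2 1 0 0 a ** mat2 0 1 1 (inverse a)"
      using a by simp
    then have "\<phi> (mat2 0 1 a 1) = borel_char \<xi>1 \<xi>2 (mat2 1 0 0 a) * \<phi> (mat2 0 1 1 (inverse a))"
      using a k K2_subset_G2 \<phi> by (metis (no_types) Ind_borel_mult B2_iff mat2_nth subsetD zero_neq_one)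
    moreover have "borel_char \<xi>1 \<xi>2 (mat2 1 0 0 a) = inverse (\<xi>2 p) ^ n * s ^ n"
      using a n sqrt_residue_card_powi[where 'a='a, of n]
      by (simp add: borel_char_def modular_B2_def \<xi> one absv_divide absv_val s_def power_int_minus
          inverse_eq_divide)
    ultimately show ?thesis
      using False k f nz n \<xi>
      by (simp add: W flat_integrand_def radial_def profile_def power_mult_distrib power_inverse)
  qed
qed

context
  fixes f :: "'a::nonarch_local_field mat2 \<Rightarrow> complex"
  assumes f: "f \<in> Cinf_K2"
begin

lemma locally_constant_on_lower: "locally_constant_on int_ring (\<lambda>a. f (mat2 1 0 a 1))"
proof (rule locally_constant_on_compose[of K2 f int_ring "\<lambda>a. mat2 1 0 a 1"])
  show "locally_constant_on K2 f"
    using f by (simp add: Cinf_K2_def)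
  show "continuous_on int_ring (\<lambda>a::'a. mat2 1 0 a 1)"
    by (rule continuous_on_mat2[OF continuous_on_const continuous_on_const continuous_on_id continuous_on_const])
  show "(\<lambda>a::'a. mat2 1 0 a 1) ` int_ring \<subseteq> K2"
    by (auto simp: K2_iff int_ring_def forall_2)
qed

lemma locally_constant_on_upper: "locally_constant_on int_ring (\<lambda>a. f (mat2 0 1 1 a))"
proof (rule locally_constant_on_compose[of K2 f int_ring "\<lambda>a. mat2 0 1 1 a"])
  show "locally_constant_on K2 f"
    using f by (simp add: Cinf_K2_def)
  show "continuous_on int_ring (\<lambda>a::'a. mat2 0 1 1 a)"
    by (rule continuous_on_mat2[OF continuous_on_const continuous_on_const continuous_on_const continuous_on_id])
  show "(\<lambda>a::'a. mat2 0 1 1 a) ` int_ring \<subseteq> K2"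
    by (auto simp: K2_iff int_ring_def forall_2)
qed

text \<open>The coordinates \<open>a\<close> and \<open>inverse a\<close> cover the projective line
  by two copies of the compact \<open>int_ring\<close>, and \<open>f\<close> is continuous on
  each.\<close>

lemma profile_bounded: "\<exists>C\<ge>0. \<forall>a. norm (profile f a) \<le> C"
proof -
  have "bounded ((\<lambda>a. f (mat2 1 0 a 1)) ` int_ring)" "bounded ((\<lambda>a. f (mat2 0 1 1 a)) ` int_ring)"
    using compact_continuous_image[OF continuous_on_locally_constant compact_int_ring]
      locally_constant_on_lower locally_constant_on_upper compact_imp_bounded by blast+
  then obtain C D where C: "\<And>a. a \<in> int_ring \<Longrightarrow> norm (f (mat2 1 0 a 1)) \<le> C"
      and D: "\<And>a. a \<in> int_ring \<Longrightarrow> norm (f (mat2 0 1 1 a)) \<le> D"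
    unfolding bounded_iff by (metis imageI)
  have "norm (profile f a) \<le> max 0 (max C D)" for a
  proof (cases "absv a \<le> 1")
    case True
    then show ?thesis
      using C[of a] by (simp add: profile_def int_ring_def)
  next
    case False
    then have "absv (inverse a) \<le> 1"
      by (simp add: absv_inverse inverse_le_1_iff)
    then show ?thesis
      using D[of "inverse a"] False by (simp add: profile_def int_ring_def)
  qed
  then show ?thesis
    by (intro exI[of _ "max 0 (max C D)"]) auto
qed

lemma profile_measurable:
  assumes "mult_haar \<mu>"
  shows "profile f \<in> borel_measurable \<mu>"
proof -
  have "continuous_on int_ring (\<lambda>a. f (mat2 1 0 a 1))"
    by (rule continuous_on_locally_constant[OF locally_constant_on_lower])
  then have c1: "continuous_on int_ring (profile f)"
    by (rule continuous_on_eq) (simp add: profile_def int_ring_def)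
  have "open {a::'a. 1 < absv a}"
    by (intro open_absv_eq) auto
  have "continuous_on {a. 1 < absv a} ((\<lambda>a. f (mat2 0 1 1 a)) \<circ> inverse)"
  proof (rule continuous_on_compose)
    show "continuous_on {a::'a. 1 < absv a} inverse"
      by (rule continuous_on_inverse_absv[OF continuous_on_id]) auto
    show "continuous_on (inverse ` {a. 1 < absv a}) (\<lambda>a. f (mat2 0 1 1 a))"
      by (rule continuous_on_subset[OF continuous_on_locally_constant[OF locally_constant_on_upper]])
        (auto simp: int_ring_def absv_inverse inverse_le_1_iff)
  qed
  then have c2: "continuous_on {a. 1 < absv a} (profile f)"
    by (rule continuous_on_eq) (simp add: profile_def)
  \<comment> \<open>Both pieces are open, so no matching condition between the two formulas
    arises.\<close>
  have "continuous_on (int_ring \<union> {a. 1 < absv a}) (profile f)"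
    by (rule continuous_on_open_Un[OF open_int_ring \<open>open {a. 1 < absv a}\<close> c1 c2])
  then have "continuous_on (- {0}) (profile f)"
    by (rule continuous_on_subset) (auto simp: int_ring_def)
  then show ?thesis
    by (rule mult_haar_measurable_continuous[OF assms])
qed

text \<open>Local constancy of \<open>f\<close> at the points \<open>a = 0\<close> and
  \<open>inverse a = 0\<close> of the projective line. The bound \<open>N \<ge> 1\<close> puts the
  two ranges of valuations into different branches of \<open>profile\<close>.\<close>

lemma profile_eventually_constant:
  obtains N where "N \<ge> 1"
    "\<And>a. a \<noteq> 0 \<Longrightarrow> N \<le> val a \<Longrightarrow> profile f a = f (mat2 1 0 0 1)"
    "\<And>a. a \<noteq> 0 \<Longrightarrow> val a \<le> - N \<Longrightarrow> profile f a = f (mat2 0 1 1 0)"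
proof -
  have *: "\<exists>N\<ge>1. \<forall>a. a \<noteq> 0 \<longrightarrow> N \<le> val a \<longrightarrow> g a = g 0"
    if g: "locally_constant_on int_ring g" for g :: "'a \<Rightarrow> complex"
  proof -
    have "\<exists>V. open V \<and> 0 \<in> V \<and> (\<forall>y\<in>V \<inter> int_ring. g y = g 0)"
      using g unfolding locally_constant_on_iff by (rule bspec) (simp add: int_ring_def)
    then obtain V where V: "open V" "0 \<in> V" "\<forall>y\<in>V \<inter> int_ring. g y = g 0"
      by (elim exE conjE)
    then obtain e where e: "e > 0" "\<And>y. dist y 0 < e \<Longrightarrow> y \<in> V"
      unfolding open_dist by blast
    have q: "residue_card TYPE('a) > 1"
      using residue_card_ge_2[where 'a='a] by simp
    then obtain n where n: "inverse (residue_card TYPE('a)) ^ n < e"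
      using real_arch_pow_inv[OF e(1), of "inverse (residue_card TYPE('a))"]
      by (auto simp: inverse_less_1_iff)
    have "g a = g 0" if a: "a \<noteq> 0" "max 1 (int n) \<le> val a" for a
    proof -
      have "absv a = residue_card TYPE('a) powi (- val a)"
        using a by (simp add: absv_val)
      also have "\<dots> \<le> residue_card TYPE('a) powi (- int n)"
        using a q by (intro power_int_increasing) auto
      also have "\<dots> < e"
        using n by (simp add: power_int_minus power_inverse)
      finally have "a \<in> V"
        using e(2)[of a] by (simp add: dist_absv)
      moreover have "a \<in> int_ring"
        using a by (simp add: int_ring_def absv_le_1_iff_val)
      ultimately show ?thesis
        using V by blast
    qed
    then show ?thesis
      by (intro exI[of _ "max 1 (int n)"]) auto
  qed
  obtain M where M: "M \<ge> 1" "\<And>a. a \<noteq> 0 \<Longrightarrow> M \<le> val a \<Longrightarrow> f (mat2 1 0 a 1) = f (mat2 1 0 0 1)"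
    using *[OF locally_constant_on_lower] by blast
  obtain L where L: "L \<ge> 1" "\<And>a. a \<noteq> 0 \<Longrightarrow> L \<le> val a \<Longrightarrow> f (mat2 0 1 1 a) = f (mat2 0 1 1 0)"
    using *[OF locally_constant_on_upper] by blast
  show ?thesis
  proof (rule that[of "max M L"])
    fix a :: 'a assume a: "a \<noteq> 0"
    show "profile f a = f (mat2 1 0 0 1)" if "max M L \<le> val a"
      using that M L a by (simp add: profile_def absv_le_1_iff_val)
    show "profile f a = f (mat2 0 1 1 0)" if "val a \<le> - max M L"
    proof -
      have "val a < 0" "L \<le> val (inverse a)"
        using that M L a by (auto simp: val_inverse)
      then show ?thesis
        using L(2)[of "inverse a"] a by (simp add: profile_def absv_le_1_iff_val)
    qed
  qed (use M in auto)
qed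

end

section \<open>Regularization\<close>

text \<open>The operator \<open>(1 - xS)(y - S)\<close>: its first factor annihilates \<open>x ^ val a\<close>, the behaviour of the
  integrand near 0, and the second one \<open>y ^ (- val a)\<close>, its behaviour near infinity.\<close>

definition twisted_difference ::
    "'a::nonarch_local_field \<Rightarrow> complex \<Rightarrow> complex \<Rightarrow> ('a \<Rightarrow> complex) \<Rightarrow> 'a \<Rightarrow> complex" where
  "twisted_difference p x y \<Psi> a = y * \<Psi> a - (x * y + 1) * \<Psi> (a / p) + x * \<Psi> (a / p\<^sup>2)"

lemma twisted_difference_add:
  "twisted_difference p x y (\<lambda>a. \<Psi> a + \<Theta> a) a =
     twisted_difference p x y \<Psi> a + twisted_difference p x y \<Theta> a"
  by (simp add: twisted_difference_def algebra_simps)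

lemma twisted_difference_scale:
  "twisted_difference p x y (\<lambda>a. c * \<Psi> a) a = c * twisted_difference p x y \<Psi> a"
  by (simp add: twisted_difference_def algebra_simps)

text \<open>Shifts preserve the integral, so integration replaces \<open>S\<close> by 1 in the
  operator, and \<open>y - (x * y + 1) + x = (1 - x) * (y - 1)\<close>. The integral is split into
  its three terms by integrability of \<open>\<Psi>\<close> itself.\<close>

lemma integral_twisted_difference:
  fixes p :: "'a::nonarch_local_field"
  assumes \<mu>: "mult_haar \<mu>" and p: "p \<noteq> 0" and \<Psi>: "integrable \<mu> \<Psi>"
  shows "(LINT a|\<mu>. twisted_difference p x y \<Psi> a) = (1 - x) * (y - 1) * (LINT a|\<mu>. \<Psi> a)"
proof -
  have int: "integrable \<mu> (\<lambda>a. \<Psi> (a / c))" and eq: "(LINT a|\<mu>. \<Psi> (a / c)) = (LINT a|\<mu>. \<Psi> a)"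
    if "c \<noteq> 0" for c
    using mult_haar_integrable_mult[OF \<mu> _ \<Psi>, of "inverse c"]
      mult_haar_integral_mult[OF \<mu> _ borel_measurable_integrable[OF \<Psi>], of "inverse c"] that
    by (simp_all add: field_simps)
  show ?thesis
    unfolding twisted_difference_def
    using \<Psi> int[of p] int[of "p\<^sup>2"] eq[of p] eq[of "p\<^sup>2"] p
    by (simp add: algebra_simps)
qed

text \<open>The parameter-free part of the term shifted \<open>j\<close> times, on one annulus. Its
  integral becomes a constant coefficient of a polynomial in \<open>x\<close> and
  \<open>y\<close>.\<close>

definition annulus_profile ::
    "'a::nonarch_local_field \<Rightarrow> ('a mat2 \<Rightarrow> complex) \<Rightarrow> nat \<Rightarrow> int \<Rightarrow> 'a \<Rightarrow> complex" where
  "annulus_profile p f j n a = (if val a = n then profile f (a / p ^ j) else 0)"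

text \<open>A bounded measurable function supported on a set of mass 1.\<close>

lemma integrable_annulus_profile:
  assumes \<mu>: "mult_haar \<mu>" and p: "uniformizer (p::'a::nonarch_local_field)" and f: "f \<in> Cinf_K2"
  shows "integrable \<mu> (annulus_profile p f j n)"
proof -
  define A where "A = {a::'a. a \<noteq> 0 \<and> val a = n}"
  obtain C where C: "C \<ge> 0" "\<And>a. norm (profile f a) \<le> C"
    using profile_bounded[OF f] by blast
  have A: "A \<in> sets \<mu>"
    unfolding A_def by (rule mult_haar_open_in_sets[OF \<mu> open_val]) simp
  have space: "space \<mu> = - {0}"
    using \<mu> by (simp add: mult_haar_def)
  have "emeasure \<mu> A < \<infinity>"
    by (simp add: A_def emeasure_mult_haar_val[OF \<mu>])
  then have "integrable \<mu> (\<lambda>a. indicator A a *\<^sub>R C)"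
    using A by (intro integrable_indicator) auto
  moreover have "annulus_profile p f j n \<in> borel_measurable \<mu>"
  proof -
    have "inverse (p ^ j) \<noteq> 0"
      using uniformizer_nonzero[OF p] by simp
    then have "(\<lambda>a. profile f (inverse (p ^ j) * a)) \<in> borel_measurable \<mu>"
      by (rule measurable_compose[OF mult_haar_measurable_mult[OF \<mu>] profile_measurable[OF f \<mu>]])
    then have "(\<lambda>a. indicator A a * profile f (inverse (p ^ j) * a)) \<in> borel_measurable \<mu>"
      using A by simp
    then show ?thesis
      by (rule measurable_cong[THEN iffD1, rotated])
        (auto simp: space A_def annulus_profile_def indicator_def field_simps)
  qed
  moreover have "AE a in \<mu>. norm (annulus_profile p f j n a) \<le> norm (indicator A a *\<^sub>R C)"
    using C by (intro AE_I2) (auto simp: space annulus_profile_def A_def)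
  ultimately show ?thesis
    by (rule Bochner_Integration.integrable_bound)
qed

lemma radial_nonneg: "0 \<le> n \<Longrightarrow> radial x y (n + 1) = x * radial x y n"
  by (simp add: radial_def nat_add_distrib)

lemma radial_neg:
  assumes "n < 0"
  shows "radial x y n = y * radial x y (n + 1)"
proof -
  have "nat (- n) = Suc (nat (- (n + 1)))"
    using assms by simp
  \<comment> \<open>For \<open>n = - 1\<close> the right-hand side involves
    \<open>radial x y 0\<close>, which is taken from the other branch.\<close>
  then show ?thesis
    using assms by (cases "n = - 1") (simp_all add: radial_def)
qed

text \<open>The range \<open>I\<close> is chosen before \<open>x\<close> and \<open>y\<close>: the
  valuations at which the profile is not yet constant depend on \<open>f\<close> only. This
  uniformity is what makes the integral one polynomial for all parameters.\<close>

lemma twisted_difference_flat_integrand_eq_sum: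
  assumes p: "uniformizer (p::'a::nonarch_local_field)" and f: "f \<in> Cinf_K2"
  shows "\<exists>I. \<forall>x y a. a \<noteq> 0 \<longrightarrow> twisted_difference p x y (flat_integrand x y f) a =
      (\<Sum>n\<in>I. y * radial x y n * annulus_profile p f 0 n a
        - (x * y + 1) * radial x y (n - 1) * annulus_profile p f 1 n a
        + x * radial x y (n - 2) * annulus_profile p f 2 n a)"
proof -
  have p0: "p \<noteq> 0"
    by (rule uniformizer_nonzero[OF p])
  obtain N where N: "N \<ge> 1"
    "\<And>a. a \<noteq> 0 \<Longrightarrow> N \<le> val a \<Longrightarrow> profile f a = f (mat2 1 0 0 1)"
    "\<And>a. a \<noteq> 0 \<Longrightarrow> val a \<le> - N \<Longrightarrow> profile f a = f (mat2 0 1 1 0)"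
    by (rule profile_eventually_constant[OF f]) (rule that, assumption, blast, blast)
  \<comment> \<open>The shifts lower the valuation by up to 2. Above, \<open>val a - 2\<close> must
    still lie in the constant range, hence the bound \<open>N + 2\<close>; below, shifting only goes
    deeper into the constant range, so \<open>- N\<close> needs no margin.\<close>
  have eq: "twisted_difference p x y (flat_integrand x y f) a =
      (\<Sum>n\<in>{- N..N + 2}. y * radial x y n * annulus_profile p f 0 n a
        - (x * y + 1) * radial x y (n - 1) * annulus_profile p f 1 n a
        + x * radial x y (n - 2) * annulus_profile p f 2 n a)"
    (is "?L = (\<Sum>n\<in>_. ?t n)") if a: "a \<noteq> 0" for x y a
  proof -
    have vals: "val (a / p) = val a - 1" "val (a / p\<^sup>2) = val a - 2"
      using a p p0 by (simp_all add: val_divide val_power val_uniformizer)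
    have L: "?L = y * radial x y (val a) * profile f a
        - (x * y + 1) * radial x y (val a - 1) * profile f (a / p)
        + x * radial x y (val a - 2) * profile f (a / p\<^sup>2)"
      by (simp add: twisted_difference_def flat_integrand_def vals)
    also have "\<dots> = ?t (val a)"
      by (simp add: annulus_profile_def)
    finally have Lt: "?L = ?t (val a)" .
    \<comment> \<open>Each \<open>a\<close> lies on a single annulus, so at most the term
      \<open>n = val a\<close> is nonzero. It remains to see that the left-hand side vanishes when
      \<open>val a\<close> is outside the range.\<close>
    have "(\<Sum>n\<in>{- N..N + 2}. ?t n) = (\<Sum>n\<in>{- N..N + 2}. if n = val a then ?t (val a) else 0)"
      by (intro sum.cong) (auto simp: annulus_profile_def)
    also have "\<dots> = (if val a \<in> {- N..N + 2} then ?t (val a) else 0)"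
      by (simp add: sum.delta)
    also have "\<dots> = ?L"
    proof (cases "val a \<in> {- N..N + 2}")
      case False
      then consider "N + 2 < val a" | "val a < - N"
        by auto
      then have "?L = 0"
      proof cases
        case 1
        have "profile f a = f (mat2 1 0 0 1)" "profile f (a / p) = f (mat2 1 0 0 1)"
            "profile f (a / p\<^sup>2) = f (mat2 1 0 0 1)"
          using 1 a p0 vals by (auto intro!: N(2))
        moreover have "radial x y (val a) = x * (x * radial x y (val a - 2))"
            "radial x y (val a - 1) = x * radial x y (val a - 2)"
          using 1 N(1) radial_nonneg[of "val a - 1" x y] radial_nonneg[of "val a - 2" x y] by auto
        ultimately show ?thesis
          unfolding L by (simp add: algebra_simps)
      next
        case 2
        have "profile f a = f (mat2 0 1 1 0)" "profile f (a / p) = f (mat2 0 1 1 0)"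
            "profile f (a / p\<^sup>2) = f (mat2 0 1 1 0)"
          using 2 a p0 vals by (auto intro!: N(3))
        moreover have "radial x y (val a - 2) = y * (y * radial x y (val a))"
            "radial x y (val a - 1) = y * radial x y (val a)"
          using 2 N(1) radial_neg[of "val a - 1" x y] radial_neg[of "val a - 2" x y] by auto
        ultimately show ?thesis
          unfolding L by (simp add: algebra_simps)
      qed
      then show ?thesis
        using False by (simp only: if_False)
    next
      case True
      then show ?thesis
        using Lt by (simp only: if_True)
    qed
    finally show ?thesis by simp
  qed
  then show ?thesis
    by (intro exI[of _ "{- N..N + 2}"]) blast
qed

text \<open>A finite sum of integrable annulus terms, for arbitrary \<open>x\<close> and
  \<open>y\<close>, even where the integrand itself is not integrable. The coefficients
  \<open>c\<close> are integrals over annuli and do not depend on \<open>x\<close> and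
  \<open>y\<close>.\<close>

lemma integral_twisted_difference_flat_integrand:
  fixes p :: "'a::nonarch_local_field"
  assumes \<mu>: "mult_haar \<mu>" and p: "uniformizer p" and f: "f \<in> Cinf_K2"
  shows "integrable \<mu> (twisted_difference p x y (flat_integrand x y f))"
    and "\<exists>I c. \<forall>x y. (LINT a|\<mu>. twisted_difference p x y (flat_integrand x y f) a) =
      (\<Sum>n\<in>I. y * radial x y n * c 0 n - (x * y + 1) * radial x y (n - 1) * c 1 n
        + x * radial x y (n - 2) * c (2::nat) n)"
proof -
  obtain I where I: "\<forall>x y a. a \<noteq> 0 \<longrightarrow> twisted_difference p x y (flat_integrand x y f) a =
      (\<Sum>n\<in>I. y * radial x y n * annulus_profile p f 0 n a
        - (x * y + 1) * radial x y (n - 1) * annulus_profile p f 1 n a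
        + x * radial x y (n - 2) * annulus_profile p f 2 n a)"
    (is "\<forall>x y a. _ \<longrightarrow> _ = ?R x y a")
    using twisted_difference_flat_integrand_eq_sum[OF p f] by (elim exE)
  have space: "space \<mu> = - {0}"
    using \<mu> by (simp add: mult_haar_def)
  have int: "integrable \<mu> (\<lambda>a. annulus_profile p f j n a)" for j n
    using integrable_annulus_profile[OF \<mu> p f] .
  have "integrable \<mu> (?R x y)"
    by (intro Bochner_Integration.integrable_sum Bochner_Integration.integrable_add
        Bochner_Integration.integrable_diff integrable_mult_right int)
  then show "integrable \<mu> (twisted_difference p x y (flat_integrand x y f))"
    by (rule Bochner_Integration.integrable_cong[THEN iffD1, rotated 2])
      (use I space in auto)
  show "\<exists>I c. \<forall>x y. (LINT a|\<mu>. twisted_difference p x y (flat_integrand x y f) a) =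
      (\<Sum>n\<in>I. y * radial x y n * c 0 n - (x * y + 1) * radial x y (n - 1) * c 1 n
        + x * radial x y (n - 2) * c (2::nat) n)"
  proof (intro exI[of _ I] exI[of _ "\<lambda>j n. LINT a|\<mu>. annulus_profile p f j n a"] allI)
    fix x y
    have "(LINT a|\<mu>. twisted_difference p x y (flat_integrand x y f) a) = (LINT a|\<mu>. ?R x y a)"
      by (rule Bochner_Integration.integral_cong) (use I space in auto)
    also have "\<dots> = (\<Sum>n\<in>I. y * radial x y n * (LINT a|\<mu>. annulus_profile p f 0 n a)
        - (x * y + 1) * radial x y (n - 1) * (LINT a|\<mu>. annulus_profile p f 1 n a)
        + x * radial x y (n - 2) * (LINT a|\<mu>. annulus_profile p f 2 n a))"
      by (subst Bochner_Integration.integral_sum) (simp_all add: int)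
    finally show "(LINT a|\<mu>. twisted_difference p x y (flat_integrand x y f) a) = \<dots>" .
  qed
qed

text \<open>Dominated by a bound of the profile times \<open>r ^ nat \<bar>val a\<bar>\<close>,
  where \<open>r\<close> is the larger of the two norms.\<close>

lemma integrable_flat_integrand:
  fixes f :: "'a::nonarch_local_field mat2 \<Rightarrow> complex"
  assumes \<mu>: "mult_haar \<mu>" and f: "f \<in> Cinf_K2" and "norm x < 1" "norm y < 1"
  shows "integrable \<mu> (flat_integrand x y f)"
proof -
  obtain C where C: "C \<ge> 0" "\<And>a. norm (profile f a) \<le> C"
    using profile_bounded[OF f] by blast
  define r where "r = max (norm x) (norm y)"
  have r: "0 \<le> r" "r < 1" "norm x \<le> r" "norm y \<le> r"
    using assms by (auto simp: r_def le_max_iff_disj)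
  have "(\<lambda>a. radial x y (val a)) \<in> borel_measurable \<mu>"
    by (rule measurable_compose[OF measurable_val[OF \<mu>]]) simp
  then have meas: "flat_integrand x y f \<in> borel_measurable \<mu>"
    unfolding flat_integrand_def using profile_measurable[OF f \<mu>] by (rule borel_measurable_times)
  have int: "integrable \<mu> (\<lambda>a. r ^ nat \<bar>val a\<bar> * C)"
    using integrable_power_abs_val[OF \<mu> r(1,2)] by simp
  have bound: "norm (flat_integrand x y f a) \<le> norm (r ^ nat \<bar>val a\<bar> * C)" for a
  proof -
    have "norm (radial x y (val a)) \<le> r ^ nat \<bar>val a\<bar>"
      using r by (auto simp: radial_def norm_power power_mono)
    then show ?thesis
      using C r by (simp add: flat_integrand_def norm_mult mult_mono)
  qed
  show ?thesis
    using int meas by (rule Bochner_Integration.integrable_bound) (intro AE_I2 bound)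
qed

section \<open>Holomorphic functions of three variables\<close>

text \<open>The condition of \<open>analytic_on3\<close> at a single point; on an open set, holding
  it at every point is enough. The closure rules are simpler in this form.\<close>

definition holomorphic3_at ::
    "(complex \<times> complex \<times> complex \<Rightarrow> complex) \<Rightarrow> complex \<times> complex \<times> complex \<Rightarrow> bool" where
  "holomorphic3_at F w \<longleftrightarrow>
     (\<exists>a b c. (F has_derivative (\<lambda>(x, y, t). a * x + b * y + c * t)) (at w))"

lemma holomorphic3_atI:
  assumes "(F has_derivative D) (at w)" "\<And>x y t. D (x, y, t) = a * x + b * y + c * t"
  shows "holomorphic3_at F w"
proof -
  have "D = (\<lambda>(x, y, t). a * x + b * y + c * t)"
    using assms(2) by auto
  then show ?thesis
    using assms(1) unfolding holomorphic3_at_def by blast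
qed

lemma holomorphic3_at_const: "holomorphic3_at (\<lambda>_. c) w"
  by (rule holomorphic3_atI[where a = 0 and b = 0 and c = 0, OF has_derivative_const]) simp

lemma holomorphic3_at_proj:
  "holomorphic3_at fst w" "holomorphic3_at (\<lambda>z. fst (snd z)) w" "holomorphic3_at (\<lambda>z. snd (snd z)) w"
proof -
  have "(fst has_derivative fst) (at w)"
      "((\<lambda>z. fst (snd z)) has_derivative (\<lambda>z. fst (snd z))) (at w)"
      "((\<lambda>z. snd (snd z)) has_derivative (\<lambda>z. snd (snd z))) (at w)"
    by (intro derivative_eq_intros | simp)+
  then show "holomorphic3_at fst w" "holomorphic3_at (\<lambda>z. fst (snd z)) w"
      "holomorphic3_at (\<lambda>z. snd (snd z)) w"
    by (auto intro: holomorphic3_atI[where a = 1 and b = 0 and c = 0]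
        holomorphic3_atI[where a = 0 and b = 1 and c = 0]
        holomorphic3_atI[where a = 0 and b = 0 and c = 1])
qed

lemma holomorphic3_at_add:
  assumes "holomorphic3_at F w" "holomorphic3_at G w"
  shows "holomorphic3_at (\<lambda>z. F z + G z) w"
proof -
  obtain a b c a' b' c' where "(F has_derivative (\<lambda>(x, y, t). a * x + b * y + c * t)) (at w)"
      "(G has_derivative (\<lambda>(x, y, t). a' * x + b' * y + c' * t)) (at w)"
    using assms unfolding holomorphic3_at_def by blast
  then show ?thesis
    by (rule holomorphic3_atI[where a = "a + a'" and b = "b + b'" and c = "c + c'", OF has_derivative_add])
      (simp add: algebra_simps)
qed

lemma holomorphic3_at_mult:
  assumes "holomorphic3_at F w" "holomorphic3_at G w"
  shows "holomorphic3_at (\<lambda>z. F z * G z) w"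
proof -
  obtain a b c a' b' c' where "(F has_derivative (\<lambda>(x, y, t). a * x + b * y + c * t)) (at w)"
      "(G has_derivative (\<lambda>(x, y, t). a' * x + b' * y + c' * t)) (at w)"
    using assms unfolding holomorphic3_at_def by blast
  then show ?thesis
    by (rule holomorphic3_atI[where a = "F w * a' + a * G w" and b = "F w * b' + b * G w"
          and c = "F w * c' + c * G w", OF has_derivative_mult])
      (simp add: algebra_simps)
qed

lemma holomorphic3_at_inverse:
  assumes "holomorphic3_at F w" "F w \<noteq> 0"
  shows "holomorphic3_at (\<lambda>z. inverse (F z)) w"
proof -
  obtain a b c where "(F has_derivative (\<lambda>(x, y, t). a * x + b * y + c * t)) (at w)"
    using assms unfolding holomorphic3_at_def by blast
  then show ?thesis
    by (rule holomorphic3_atI[where a = "- (inverse (F w) * a * inverse (F w))"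
          and b = "- (inverse (F w) * b * inverse (F w))"
          and c = "- (inverse (F w) * c * inverse (F w))", OF Deriv.has_derivative_inverse[of F w, OF assms(2)]])
      (simp add: algebra_simps)
qed

lemma holomorphic3_at_diff:
  assumes "holomorphic3_at F w" "holomorphic3_at G w"
  shows "holomorphic3_at (\<lambda>z. F z - G z) w"
  using holomorphic3_at_add[OF assms(1) holomorphic3_at_mult[OF holomorphic3_at_const assms(2), of "- 1"]]
  by simp

lemma holomorphic3_at_divide:
  assumes "holomorphic3_at F w" "holomorphic3_at G w" "G w \<noteq> 0"
  shows "holomorphic3_at (\<lambda>z. F z / G z) w"
  using holomorphic3_at_mult[OF assms(1) holomorphic3_at_inverse[OF assms(2,3)]]
  by (simp add: divide_inverse)

lemma holomorphic3_at_power: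
  "holomorphic3_at F w \<Longrightarrow> holomorphic3_at (\<lambda>z. F z ^ n) w"
  by (induction n) (auto intro: holomorphic3_at_const holomorphic3_at_mult)

lemma holomorphic3_at_sum:
  "(\<And>i. i \<in> I \<Longrightarrow> holomorphic3_at (F i) w) \<Longrightarrow> holomorphic3_at (\<lambda>z. \<Sum>i\<in>I. F i z) w"
  by (induction I rule: infinite_finite_induct)
    (auto intro: holomorphic3_at_const holomorphic3_at_add)

lemma holomorphic3_at_radial:
  "holomorphic3_at F w \<Longrightarrow> holomorphic3_at G w \<Longrightarrow> holomorphic3_at (\<lambda>z. radial (F z) (G z) n) w"
  by (cases "0 \<le> n") (simp_all add: radial_def holomorphic3_at_power)

lemma analytic_on3_imp_holomorphic3_at: "analytic_on3 F S \<Longrightarrow> w \<in> S \<Longrightarrow> holomorphic3_at F w"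
  unfolding analytic_on3_def holomorphic3_at_def by (meson centre_in_ball)

lemma analytic_on3_open:
  assumes "open S" "\<And>w. w \<in> S \<Longrightarrow> holomorphic3_at F w"
  shows "analytic_on3 F S"
  unfolding analytic_on3_def holomorphic3_at_def[symmetric]
  using assms by (meson open_contains_ball subsetD)

text \<open>Chain rule along a complex curve: composing the two complex linear derivatives gives
  multiplication by one complex number. This makes the one-variable identity theorem applicable to
  coordinate slices.\<close>

lemma holomorphic3_at_slice:
  assumes "holomorphic3_at F w" "(g has_derivative D) (at u)" "g u = w"
    "\<And>h. D h = (a * h, b * h, c * h)"
  shows "(\<lambda>u. F (g u)) field_differentiable (at u)"
proof -
  obtain a' b' c' where F: "(F has_derivative (\<lambda>(x, y, t). a' * x + b' * y + c' * t)) (at (g u))"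
    using assms(1,3) unfolding holomorphic3_at_def by blast
  have "((\<lambda>u. F (g u)) has_derivative (\<lambda>h. (case D h of (x, y, t) \<Rightarrow> a' * x + b' * y + c' * t))) (at u)"
    by (rule has_derivative_compose[OF assms(2) F])
  moreover have "(\<lambda>h. (case D h of (x, y, t) \<Rightarrow> a' * x + b' * y + c' * t)) = (*) (a' * a + b' * b + c' * c)"
    by (auto simp: assms(4) algebra_simps)
  ultimately show ?thesis
    unfolding field_differentiable_def has_field_derivative_def by metis
qed

section \<open>The parameter domains and uniqueness of analytic continuation\<close>

lemma Lambda_domain_iff:
  assumes "q > 0"
  defines "s \<equiv> complex_of_real (q powr (-1/2))"
  shows "(\<gamma>1, \<gamma>2, \<tau>) \<in> Lambda_domain q \<longleftrightarrow>
    \<gamma>1 \<noteq> 0 \<and> \<gamma>2 \<noteq> 0 \<and> \<tau> \<noteq> 0 \<and> \<gamma>1 \<noteq> \<tau> / s \<and> \<gamma>2 \<noteq> \<tau> * s"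
proof -
  have s0: "s \<noteq> 0"
    using assms by simp
  have "complex_of_real (q powr (1/2)) = inverse s"
    using assms by (simp add: powr_minus)
  then show ?thesis
    using s0 unfolding Lambda_domain_def s_def[symmetric] by (auto simp: field_simps)
qed

lemma convergence_domain_iff:
  assumes "q > 0"
  defines "s \<equiv> complex_of_real (q powr (-1/2))"
  shows "(\<gamma>1, \<gamma>2, \<tau>) \<in> convergence_domain q \<longleftrightarrow>
    \<gamma>1 \<noteq> 0 \<and> \<gamma>2 \<noteq> 0 \<and> \<tau> \<noteq> 0 \<and> norm (\<gamma>1 * inverse \<tau> * s) < 1 \<and> norm (inverse \<gamma>2 * \<tau> * s) < 1"
proof -
  have s: "norm s = inverse (q powr (1/2))"
    unfolding s_def norm_of_real by (simp add: powr_minus)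
  have "q powr (1/2) > 0"
    using assms by simp
  then have "norm (u * s) < 1 \<longleftrightarrow> norm u < q powr (1/2)" for u
    by (simp add: norm_mult s field_simps)
  then show ?thesis
    by (simp add: convergence_domain_def)
qed

lemma convergence_domain_subset: "q > 0 \<Longrightarrow> convergence_domain q \<subseteq> Lambda_domain q"
proof
  fix z assume q: "q > 0" and z: "z \<in> convergence_domain q"
  obtain \<gamma>1 \<gamma>2 \<tau> where z_eq: "z = (\<gamma>1, \<gamma>2, \<tau>)"
    by (rule prod_cases3)
  define s where "s = complex_of_real (q powr (-1/2))"
  have "s \<noteq> 0"
    using q by (simp add: s_def)
  have c: "\<gamma>1 \<noteq> 0" "\<gamma>2 \<noteq> 0" "\<tau> \<noteq> 0" "norm (\<gamma>1 * inverse \<tau> * s) < 1" "norm (inverse \<gamma>2 * \<tau> * s) < 1"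
    using z unfolding z_eq convergence_domain_iff[OF q] s_def by blast+
  have "\<gamma>1 * inverse \<tau> * s = 1" if "\<gamma>1 = \<tau> / s"
    using that c \<open>s \<noteq> 0\<close> by simp
  moreover have "inverse \<gamma>2 * \<tau> * s = 1" if "\<gamma>2 = \<tau> * s"
    using that c \<open>s \<noteq> 0\<close> by (simp add: field_simps)
  ultimately have "\<gamma>1 \<noteq> \<tau> / s" "\<gamma>2 \<noteq> \<tau> * s"
    using c(4,5) by force+
  then show "z \<in> Lambda_domain q"
    using c(1-3) unfolding z_eq Lambda_domain_iff[OF q] s_def by blast
qed

lemma open_Lambda_domain:
  assumes "q > 0"
  shows "open (Lambda_domain q)"
proof -
  define s where "s = complex_of_real (q powr (-1/2))"
  have "Lambda_domain q = {z. fst z \<noteq> 0} \<inter> {z. fst (snd z) \<noteq> 0} \<inter> {z. snd (snd z) \<noteq> 0} \<inter>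
      {z. fst z \<noteq> snd (snd z) * inverse s} \<inter> {z. fst (snd z) \<noteq> snd (snd z) * s}"
  proof (rule set_eqI)
    fix z :: "complex \<times> complex \<times> complex"
    obtain \<gamma>1 \<gamma>2 \<tau> where z: "z = (\<gamma>1, \<gamma>2, \<tau>)"
      by (rule prod_cases3)
    show "z \<in> Lambda_domain q \<longleftrightarrow> z \<in> {z. fst z \<noteq> 0} \<inter> {z. fst (snd z) \<noteq> 0} \<inter> {z. snd (snd z) \<noteq> 0} \<inter>
      {z. fst z \<noteq> snd (snd z) * inverse s} \<inter> {z. fst (snd z) \<noteq> snd (snd z) * s}"
      unfolding z Lambda_domain_iff[OF assms] s_def[symmetric]
      by (simp add: divide_inverse[of _ s])
  qed
  also have "open \<dots>"
    by (intro open_Int open_Collect_neq continuous_intros)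
  finally show ?thesis .
qed

text \<open>The identity theorem in the first variable extends the equality to all parameters with
  \<open>norm (inverse \<gamma>2 * \<tau>) < q powr (1/2)\<close>; the identity theorem in the second variable removes this
  condition.\<close>

lemma analytic_on3_Lambda_domain_unique:
  assumes q: "q > 0"
    and F: "analytic_on3 F (Lambda_domain q)" and G: "analytic_on3 G (Lambda_domain q)"
    and eq: "\<And>z. z \<in> convergence_domain q \<Longrightarrow> F z = G z"
    and z: "z \<in> Lambda_domain q"
  shows "F z = G z"
proof -
  define s where "s = complex_of_real (q powr (-1/2))"
  have s0: "s \<noteq> 0"
    using q by (simp add: s_def)
  note Lambda_iff = Lambda_domain_iff[OF q, folded s_def]
  note conv_iff = convergence_domain_iff[OF q, folded s_def]
  have conn: "connected (- {a, b} :: complex set)" for a b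
    unfolding Compl_eq_Diff_UNIV
    by (rule connected_open_delete_finite) (simp_all add: convex_connected)
  have op: "open (- {a, b} :: complex set)" for a b
    by (simp add: open_Compl)
  have hol1: "(\<lambda>g. H (g, \<gamma>2, \<tau>)) holomorphic_on - {0, \<tau> / s}"
    if H: "analytic_on3 H (Lambda_domain q)" and nz: "\<gamma>2 \<noteq> 0" "\<tau> \<noteq> 0" "\<gamma>2 \<noteq> \<tau> * s" for H \<gamma>2 \<tau>
  proof (rule holomorphic_onI)
    fix u assume "u \<in> - {0, \<tau> / s}"
    then have "(u, \<gamma>2, \<tau>) \<in> Lambda_domain q"
      using nz by (simp add: Lambda_iff)
    then have H': "holomorphic3_at H (u, \<gamma>2, \<tau>)"
      by (rule analytic_on3_imp_holomorphic3_at[OF H])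
    have "((\<lambda>g. (g, \<gamma>2, \<tau>)) has_derivative (\<lambda>h. (h, 0, 0))) (at u)"
      by (intro derivative_intros)
    from holomorphic3_at_slice[OF H' this, of 1 0 0]
    show "(\<lambda>g. H (g, \<gamma>2, \<tau>)) field_differentiable at u within - {0, \<tau> / s}"
      by (simp add: field_differentiable_at_within)
  qed
  have hol2: "(\<lambda>g. H (\<gamma>1, g, \<tau>)) holomorphic_on - {0, \<tau> * s}"
    if H: "analytic_on3 H (Lambda_domain q)" and nz: "\<gamma>1 \<noteq> 0" "\<tau> \<noteq> 0" "\<gamma>1 \<noteq> \<tau> / s" for H \<gamma>1 \<tau>
  proof (rule holomorphic_onI)
    fix u assume "u \<in> - {0, \<tau> * s}"
    then have "(\<gamma>1, u, \<tau>) \<in> Lambda_domain q"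
      using nz by (simp add: Lambda_iff)
    then have H': "holomorphic3_at H (\<gamma>1, u, \<tau>)"
      by (rule analytic_on3_imp_holomorphic3_at[OF H])
    have "((\<lambda>g. (\<gamma>1, g, \<tau>)) has_derivative (\<lambda>h. (0, h, 0))) (at u)"
      by (intro derivative_intros)
    from holomorphic3_at_slice[OF H' this, of 0 1 0]
    show "(\<lambda>g. H (\<gamma>1, g, \<tau>)) field_differentiable at u within - {0, \<tau> * s}"
      by (simp add: field_differentiable_at_within)
  qed
  have step1: "F (\<gamma>1, \<gamma>2, \<tau>) = G (\<gamma>1, \<gamma>2, \<tau>)"
    if L: "(\<gamma>1, \<gamma>2, \<tau>) \<in> Lambda_domain q" and n: "norm (inverse \<gamma>2 * \<tau> * s) < 1" for \<gamma>1 \<gamma>2 \<tau>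
  proof -
    have nz: "\<gamma>1 \<noteq> 0" "\<gamma>2 \<noteq> 0" "\<tau> \<noteq> 0" "\<gamma>1 \<noteq> \<tau> / s" "\<gamma>2 \<noteq> \<tau> * s"
      using L by (auto simp: Lambda_iff)
    \<comment> \<open>For fixed \<tau>, the bound on the first ratio means that \<gamma>1 lies in
      the disc of radius \<open>norm (\<tau> / s)\<close>. The excluded value
      \<open>\<tau> / s\<close> is on its boundary, so only 0 has to be removed.\<close>
    define U where "U = ball 0 (norm (\<tau> / s)) - {0::complex}"
    have "norm (\<tau> / s / 2) < norm (\<tau> / s)"
      unfolding norm_divide[of "\<tau> / s" 2] using nz s0 by simp
    then have "\<tau> / s / 2 \<in> U"
      using nz s0 by (simp add: U_def)
    have U: "F (g, \<gamma>2, \<tau>) = G (g, \<gamma>2, \<tau>)" if "g \<in> U" for g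
    proof (rule eq)
      have "norm (g * inverse \<tau> * s) < 1"
        using that nz s0 by (simp add: U_def norm_mult norm_divide norm_inverse field_simps)
      then show "(g, \<gamma>2, \<tau>) \<in> convergence_domain q"
        using that nz n by (simp add: conv_iff U_def)
    qed
    show ?thesis
    proof (rule analytic_continuation_open[of U "- {0, \<tau> / s}" "\<lambda>g. F (g, \<gamma>2, \<tau>)" "\<lambda>g. G (g, \<gamma>2, \<tau>)"])
      show "open U"
        by (auto simp: U_def)
      show "U \<noteq> {}"
        using \<open>\<tau> / s / 2 \<in> U\<close> by auto
      show "U \<subseteq> - {0, \<tau> / s}"
        by (auto simp: U_def)
    qed (use nz op conn U hol1[OF F] hol1[OF G] in auto)
  qed
  obtain \<gamma>1 \<gamma>2 \<tau> where z_eq: "z = (\<gamma>1, \<gamma>2, \<tau>)"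
    by (rule prod_cases3)
  have nz: "\<gamma>1 \<noteq> 0" "\<gamma>2 \<noteq> 0" "\<tau> \<noteq> 0" "\<gamma>1 \<noteq> \<tau> / s" "\<gamma>2 \<noteq> \<tau> * s"
    using z by (auto simp: z_eq Lambda_iff)
  \<comment> \<open>The second ratio has \<gamma>2 in the denominator, so its bound describes the
    exterior of a disc. There the first step already gives equality, with no bound on
    \<gamma>1.\<close>
  define U where "U = - cball (0::complex) (norm (\<tau> * s))"
  have "norm (\<tau> * s) < norm (\<tau> * s * 2)"
    using nz s0 norm_mult[of "\<tau> * s" 2] by simp
  then have "\<tau> * s * 2 \<in> U"
    by (simp add: U_def)
  have U: "F (\<gamma>1, g, \<tau>) = G (\<gamma>1, g, \<tau>)" if "g \<in> U" for g
  proof (rule step1)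
    have g: "norm (\<tau> * s) < norm g"
      using that by (simp add: U_def)
    then have "norm g > 0"
      by (smt (verit) norm_ge_zero)
    have "inverse g * \<tau> * s = \<tau> * s / g"
      by (simp add: divide_inverse)
    then have "norm (inverse g * \<tau> * s) = norm (\<tau> * s) / norm g"
      by (simp only: norm_divide)
    then show "norm (inverse g * \<tau> * s) < 1"
      using g \<open>norm g > 0\<close> by (simp only: divide_less_eq_1_pos)
    show "(\<gamma>1, g, \<tau>) \<in> Lambda_domain q"
      using g \<open>norm g > 0\<close> nz by (auto simp: Lambda_iff)
  qed
  have "F (\<gamma>1, \<gamma>2, \<tau>) = G (\<gamma>1, \<gamma>2, \<tau>)"
  proof (rule analytic_continuation_open[of U "- {0, \<tau> * s}" "\<lambda>g. F (\<gamma>1, g, \<tau>)" "\<lambda>g. G (\<gamma>1, g, \<tau>)"])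
    show "open U"
      by (auto simp: U_def)
    show "U \<noteq> {}"
      using \<open>\<tau> * s * 2 \<in> U\<close> by auto
    show "U \<subseteq> - {0, \<tau> * s}"
      by (auto simp: U_def)
  qed (use nz op conn U hol2[OF F] hol2[OF G] in auto)
  then show ?thesis
    by (simp add: z_eq)
qed

section \<open>The continuation\<close>

text \<open>The quotients \<open>x\<close> and \<open>y\<close> of the geometric behaviour of the
  integrand near 0 and near infinity, as functions of the parameters.\<close>

definition ratio_zero :: "real \<Rightarrow> complex \<times> complex \<times> complex \<Rightarrow> complex" where
  "ratio_zero q z = fst z * inverse (snd (snd z)) * complex_of_real (q powr (-1/2))"

definition ratio_inf :: "real \<Rightarrow> complex \<times> complex \<times> complex \<Rightarrow> complex" where
  "ratio_inf q z = inverse (fst (snd z)) * snd (snd z) * complex_of_real (q powr (-1/2))"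

definition W_regularized ::
    "'a::nonarch_local_field \<Rightarrow> 'a measure \<Rightarrow> ('a mat2 \<Rightarrow> complex) \<Rightarrow>
     complex \<times> complex \<times> complex \<Rightarrow> complex" where
  "W_regularized p \<mu> f z =
     (let x = ratio_zero (residue_card TYPE('a)) z; y = ratio_inf (residue_card TYPE('a)) z
      in (LINT a|\<mu>. twisted_difference p x y (flat_integrand x y f) a) / ((1 - x) * (y - 1)))"

text \<open>Solved for the ratios, the two inequations that define \<open>Lambda_domain\<close> say
  that the denominator of \<open>W_regularized\<close> does not vanish.\<close>

lemma ratio_neq_1:
  assumes "q > 0" "z \<in> Lambda_domain q"
  shows "ratio_zero q z \<noteq> 1" "ratio_inf q z \<noteq> 1"
proof -
  obtain \<gamma>1 \<gamma>2 \<tau> where z: "z = (\<gamma>1, \<gamma>2, \<tau>)"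
    by (rule prod_cases3)
  define s where "s = complex_of_real (q powr (-1/2))"
  have "s \<noteq> 0"
    using assms by (simp add: s_def)
  have nz: "\<gamma>1 \<noteq> 0" "\<gamma>2 \<noteq> 0" "\<tau> \<noteq> 0" "\<gamma>1 \<noteq> \<tau> / s" "\<gamma>2 \<noteq> \<tau> * s"
    using assms(2) unfolding z Lambda_domain_iff[OF assms(1)] s_def by blast+
  have r: "ratio_zero q z = \<gamma>1 * inverse \<tau> * s" "ratio_inf q z = inverse \<gamma>2 * \<tau> * s"
    by (simp_all add: ratio_zero_def ratio_inf_def z s_def)
  show "ratio_zero q z \<noteq> 1" "ratio_inf q z \<noteq> 1"
    unfolding r using nz \<open>s \<noteq> 0\<close> by (auto simp: field_simps)
qed

text \<open>A polynomial in the two ratios divided by a nonvanishing product; the ratios are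
  themselves rational in the parameters, with denominators \<tau> and \<gamma>2.\<close>

lemma analytic_W_regularized:
  fixes p :: "'a::nonarch_local_field"
  assumes \<mu>: "mult_haar \<mu>" and p: "uniformizer p" and f: "f \<in> Cinf_K2"
  shows "analytic_on3 (W_regularized p \<mu> f) (Lambda_domain (residue_card TYPE('a)))"
proof (rule analytic_on3_open[OF open_Lambda_domain[OF residue_card_pos]])
  fix w assume w: "w \<in> Lambda_domain (residue_card TYPE('a))"
  define X where "X = ratio_zero (residue_card TYPE('a))"
  define Y where "Y = ratio_inf (residue_card TYPE('a))"
  obtain I c where "\<forall>x y. (LINT a|\<mu>. twisted_difference p x y (flat_integrand x y f) a) =
      (\<Sum>n\<in>I. y * radial x y n * c 0 n - (x * y + 1) * radial x y (n - 1) * c 1 n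
        + x * radial x y (n - 2) * c (2::nat) n)"
    using integral_twisted_difference_flat_integrand(2)[OF \<mu> p f] by (elim exE)
  then have W: "W_regularized p \<mu> f = (\<lambda>z. (\<Sum>n\<in>I. Y z * radial (X z) (Y z) n * c 0 n
      - (X z * Y z + 1) * radial (X z) (Y z) (n - 1) * c 1 n
      + X z * radial (X z) (Y z) (n - 2) * c 2 n) / ((1 - X z) * (Y z - 1)))"
    by (simp add: fun_eq_iff W_regularized_def X_def Y_def Let_def)
  have nz: "fst (snd w) \<noteq> 0" "snd (snd w) \<noteq> 0"
    using w by (auto simp: Lambda_domain_def)
  have X: "holomorphic3_at X w" and Y: "holomorphic3_at Y w"
    unfolding X_def Y_def ratio_zero_def ratio_inf_def
    by (intro holomorphic3_at_mult holomorphic3_at_inverse holomorphic3_at_proj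
        holomorphic3_at_const nz)+
  have "(1 - X w) * (Y w - 1) \<noteq> 0"
    using ratio_neq_1[OF residue_card_pos w] by (simp add: X_def Y_def)
  then show "holomorphic3_at (W_regularized p \<mu> f) w"
    unfolding W
    by (intro holomorphic3_at_divide holomorphic3_at_sum holomorphic3_at_add holomorphic3_at_diff
        holomorphic3_at_mult holomorphic3_at_radial holomorphic3_at_const X Y)
qed

lemma has_parameters_unramified:
  assumes "has_parameters p \<xi>1 \<xi>2 \<sigma> z"
  shows "unramified \<xi>1" "unramified \<xi>2" "unramified \<sigma>"
  using assms by (auto simp: has_parameters_def)

lemma W_integrand_eq_flat_integrand_ratio:
  fixes p :: "'a::nonarch_local_field"
  assumes p: "uniformizer p" and z: "has_parameters p \<xi>1 \<xi>2 \<sigma> z"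
    and \<phi>: "Ind_extension \<xi>1 \<xi>2 f \<phi>" and a: "a \<noteq> 0"
  shows "W_integrand \<sigma> \<phi> a = flat_integrand (ratio_zero (residue_card TYPE('a)) z)
    (ratio_inf (residue_card TYPE('a)) z) f a"
proof -
  have "\<phi> \<in> Ind \<xi>1 \<xi>2" "\<And>k. k \<in> K2 \<Longrightarrow> f k = \<phi> k"
    using \<phi> by (auto simp: Ind_extension_def)
  from W_integrand_eq_flat_integrand[OF has_parameters_unramified[OF z] p this a]
  show ?thesis
    using z by (simp add: has_parameters_def ratio_zero_def ratio_inf_def)
qed

lemma integrable_W_integrand:
  fixes p :: "'a::nonarch_local_field"
  assumes \<mu>: "mult_haar \<mu>" and p: "uniformizer p" and f: "f \<in> Cinf_K2"
    and conv: "z \<in> convergence_domain (residue_card TYPE('a))"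
    and z: "has_parameters p \<xi>1 \<xi>2 \<sigma> z" and \<phi>: "Ind_extension \<xi>1 \<xi>2 f \<phi>"
  shows "integrable \<mu> (W_integrand \<sigma> \<phi>)"
    and "W_regularized p \<mu> f z = W_integral \<mu> \<sigma> \<phi>"
proof -
  define x where "x = ratio_zero (residue_card TYPE('a)) z"
  define y where "y = ratio_inf (residue_card TYPE('a)) z"
  have space: "space \<mu> = - {0}"
    using \<mu> by (simp add: mult_haar_def)
  obtain \<gamma>1 \<gamma>2 \<tau> where z_eq: "z = (\<gamma>1, \<gamma>2, \<tau>)"
    by (rule prod_cases3)
  have "norm x < 1" "norm y < 1"
    using conv unfolding z_eq x_def y_def ratio_zero_def ratio_inf_def fst_conv snd_conv
      convergence_domain_iff[OF residue_card_pos] by blast+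
  then have int: "integrable \<mu> (flat_integrand x y f)"
    by (rule integrable_flat_integrand[OF \<mu> f])
  have eq: "W_integrand \<sigma> \<phi> a = flat_integrand x y f a" if "a \<in> space \<mu>" for a
    using W_integrand_eq_flat_integrand_ratio[OF p z \<phi>, of a] that
    by (simp add: space x_def y_def)
  show "integrable \<mu> (W_integrand \<sigma> \<phi>)"
    using int by (rule Bochner_Integration.integrable_cong[THEN iffD1, rotated 2])
      (simp_all add: eq)
  have "W_integral \<mu> \<sigma> \<phi> = (LINT a|\<mu>. flat_integrand x y f a)"
    unfolding W_integral_def by (rule Bochner_Integration.integral_cong) (simp_all add: eq)
  \<comment> \<open>The convergence domain lies inside \<open>Lambda_domain\<close>, so the factor
    introduced by the operator can be cancelled.\<close>
  moreover have "(1 - x) * (y - 1) \<noteq> 0"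
    using ratio_neq_1[OF residue_card_pos, of z] conv convergence_domain_subset[OF residue_card_pos]
    by (auto simp: x_def y_def)
  ultimately show "W_regularized p \<mu> f z = W_integral \<mu> \<sigma> \<phi>"
    using integral_twisted_difference[OF \<mu> uniformizer_nonzero[OF p] int, of x y]
    by (simp add: W_regularized_def Let_def flip: x_def y_def)
qed

lemma W_continuation_W_regularized:
  assumes "mult_haar \<mu>" "uniformizer p" "f \<in> Cinf_K2"
  shows "W_continuation p \<mu> f (W_regularized p \<mu> f)"
  unfolding W_continuation_def
  using analytic_W_regularized[OF assms] integrable_W_integrand(2)[OF assms] by blast

text \<open>At each point of the convergence domain there are characters and an extension of
  \<open>f\<close>, so both continuations equal the same integral there, and the identity theorem
  applies.\<close>

lemma W_continuation_unique:
  fixes p :: "'a::nonarch_local_field"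
  assumes p: "uniformizer p" and f: "f \<in> Cinf_K2"
    and A: "W_continuation p \<mu> f A" and B: "W_continuation p \<mu> f B"
    and z: "z \<in> Lambda_domain (residue_card TYPE('a))"
  shows "A z = B z"
proof (rule analytic_on3_Lambda_domain_unique[OF residue_card_pos _ _ _ z])
  show "analytic_on3 A (Lambda_domain (residue_card TYPE('a)))"
      "analytic_on3 B (Lambda_domain (residue_card TYPE('a)))"
    using A B by (simp_all add: W_continuation_def)
  fix w assume w: "w \<in> convergence_domain (residue_card TYPE('a))"
  then have "w \<in> Lambda_domain (residue_card TYPE('a))"
    using convergence_domain_subset[OF residue_card_pos] by blast
  then obtain \<xi>1 \<xi>2 \<sigma> where h: "has_parameters p \<xi>1 \<xi>2 \<sigma> w"
    using ex_has_parameters[OF p] by blast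
  then obtain \<phi> where \<phi>: "Ind_extension \<xi>1 \<xi>2 f \<phi>"
    using ex_Ind_extension[OF f] has_parameters_unramified by blast
  have "A w = W_integral \<mu> \<sigma> \<phi>" "B w = W_integral \<mu> \<sigma> \<phi>"
    using A B w h \<phi> unfolding W_continuation_def by blast+
  then show "A w = B w"
    by simp
qed

text \<open>Expresses the regularized value through \<phi> itself at the given parameters, inside or
  outside the convergence domain. A translate of \<phi> can then be handled without computing its
  restriction to \<open>K2\<close>.\<close>

lemma W_regularized_restrict_K2:
  fixes p :: "'a::nonarch_local_field"
  assumes \<mu>: "mult_haar \<mu>" and p: "uniformizer p" and z: "has_parameters p \<xi>1 \<xi>2 \<sigma> z"
    and \<phi>: "\<phi> \<in> Ind \<xi>1 \<xi>2"
  defines "x \<equiv> ratio_zero (residue_card TYPE('a)) z"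
    and "y \<equiv> ratio_inf (residue_card TYPE('a)) z"
  shows "integrable \<mu> (twisted_difference p x y (W_integrand \<sigma> \<phi>))"
    and "W_regularized p \<mu> (restrict_K2 \<phi>) z =
      (LINT a|\<mu>. twisted_difference p x y (W_integrand \<sigma> \<phi>) a) / ((1 - x) * (y - 1))"
proof -
  have f: "restrict_K2 \<phi> \<in> Cinf_K2"
    by (rule restrict_K2_in_Cinf_K2[OF \<phi> has_parameters_unramified(1,2)[OF z]])
  have ext: "Ind_extension \<xi>1 \<xi>2 (restrict_K2 \<phi>) \<phi>"
    by (rule Ind_extension_restrict_K2[OF \<phi>])
  have space: "space \<mu> = - {0}"
    using \<mu> by (simp add: mult_haar_def)
  have eq: "twisted_difference p x y (W_integrand \<sigma> \<phi>) a =
      twisted_difference p x y (flat_integrand x y (restrict_K2 \<phi>)) a" if "a \<in> space \<mu>" for a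
    using that uniformizer_nonzero[OF p] W_integrand_eq_flat_integrand_ratio[OF p z ext]
    by (simp add: twisted_difference_def space x_def y_def)
  have "integrable \<mu> (twisted_difference p x y (flat_integrand x y (restrict_K2 \<phi>)))"
    by (rule integral_twisted_difference_flat_integrand(1)[OF \<mu> p f])
  then show "integrable \<mu> (twisted_difference p x y (W_integrand \<sigma> \<phi>))"
    by (rule Bochner_Integration.integrable_cong[THEN iffD1, rotated 2]) (simp_all add: eq)
  have "(LINT a|\<mu>. twisted_difference p x y (W_integrand \<sigma> \<phi>) a) =
      (LINT a|\<mu>. twisted_difference p x y (flat_integrand x y (restrict_K2 \<phi>)) a)"
    by (rule Bochner_Integration.integral_cong) (simp_all add: eq)
  then show "W_regularized p \<mu> (restrict_K2 \<phi>) z =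
      (LINT a|\<mu>. twisted_difference p x y (W_integrand \<sigma> \<phi>) a) / ((1 - x) * (y - 1))"
    by (simp add: W_regularized_def Let_def flip: x_def y_def)
qed

text \<open>Write \<open>t\<close> as the scalar \<open>b\<close> times \<open>diag(a, 1)\<close>.
  The scalar acts through the central character, as its modulus is 1; the other factor replaces
  \<open>s\<close> by \<open>a * s\<close>, and passing from the inverse of
  \<open>\<sigma> s\<close> to that of \<open>\<sigma> (a * s)\<close> leaves the factor
  \<open>\<sigma> a\<close>.\<close>

lemma W_integrand_right_translate:
  fixes v :: "'a::nonarch_local_field mat2 \<Rightarrow> complex"
  assumes unr: "unramified \<xi>1" "unramified \<xi>2" "unramified \<sigma>"
    and v: "v \<in> Ind \<xi>1 \<xi>2" and t: "t \<in> T2" and s: "s \<noteq> 0"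
  shows "W_integrand \<sigma> (right_translate t v) s =
    torus_char \<xi>1 \<xi>2 \<sigma> t * W_integrand \<sigma> v (t $ 1 $ 1 / t $ 2 $ 2 * s)"
proof -
  define b where "b = t $ 2 $ 2"
  define a where "a = t $ 1 $ 1 / b"
  have nz: "b \<noteq> 0" "a \<noteq> 0"
    using t by (auto simp: T2_iff a_def b_def)
  have t_eq: "t = mat2 (a * b) 0 0 b"
    using t mat2_eta[of t] by (simp add: T2_iff a_def b_def)
  have "mat2 0 1 s 1 ** t = mat2 b 0 0 b ** mat2 0 1 (a * s) 1"
    by (simp add: t_eq)
  moreover have "v (mat2 b 0 0 b ** mat2 0 1 (a * s) 1) =
      borel_char \<xi>1 \<xi>2 (mat2 b 0 0 b) * v (mat2 0 1 (a * s) 1)"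
    using nz s by (intro Ind_borel_mult[OF v]) (simp_all add: B2_iff G2_iff)
  moreover have "borel_char \<xi>1 \<xi>2 (mat2 b 0 0 b) = \<xi>1 b * \<xi>2 b"
    using nz by (simp add: borel_char_def modular_B2_def)
  ultimately have "v (mat2 0 1 s 1 ** t) = \<xi>1 b * \<xi>2 b * v (mat2 0 1 (a * s) 1)"
    by simp
  moreover have "\<sigma> (a * s) = \<sigma> a * \<sigma> s" "\<sigma> a \<noteq> 0"
    using nz s unr by (simp_all add: unramified_mult unramified_nonzero)
  ultimately have "W_integrand \<sigma> (right_translate t v) s =
      \<sigma> a * (\<xi>1 b * \<xi>2 b) * W_integrand \<sigma> v (a * s)"
    by (simp add: W_integrand_def right_translate_def)
  then show ?thesis
    by (simp add: torus_char_def Let_def a_def b_def)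
qed

lemma waldspurger_functional_W_regularized:
  fixes p :: "'a::nonarch_local_field"
  assumes \<mu>: "mult_haar \<mu>" and p: "uniformizer p" and z: "has_parameters p \<xi>1 \<xi>2 \<sigma> z"
  shows "waldspurger_functional \<xi>1 \<xi>2 \<sigma> (\<lambda>\<phi>. W_regularized p \<mu> (restrict_K2 \<phi>) z)"
proof -
  define x where "x = ratio_zero (residue_card TYPE('a)) z"
  define y where "y = ratio_inf (residue_card TYPE('a)) z"

  note int = W_regularized_restrict_K2(1)[OF \<mu> p z, folded x_def y_def]
  note W = W_regularized_restrict_K2(2)[OF \<mu> p z, folded x_def y_def]
  note unr = has_parameters_unramified[OF z]
  have space: "space \<mu> = - {0}"
    using \<mu> by (simp add: mult_haar_def)
  show ?thesis
    unfolding waldspurger_functional_def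
  proof (intro conjI ballI allI)
    fix u v assume u: "u \<in> Ind \<xi>1 \<xi>2" and v: "v \<in> Ind \<xi>1 \<xi>2"
    have "W_integrand \<sigma> (\<lambda>g. u g + v g) = (\<lambda>a. W_integrand \<sigma> u a + W_integrand \<sigma> v a)"
      by (simp add: fun_eq_iff W_integrand_def algebra_simps)
    then show "W_regularized p \<mu> (restrict_K2 (\<lambda>g. u g + v g)) z =
        W_regularized p \<mu> (restrict_K2 u) z + W_regularized p \<mu> (restrict_K2 v) z"
      using int[OF u] int[OF v]
      by (simp add: W[OF Ind_add[OF u v]] W[OF u] W[OF v] twisted_difference_add add_divide_distrib)
  next
    fix c v assume v: "v \<in> Ind \<xi>1 \<xi>2"
    have "W_integrand \<sigma> (\<lambda>g. c * v g) = (\<lambda>a. c * W_integrand \<sigma> v a)"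
      by (simp add: fun_eq_iff W_integrand_def)
    then show "W_regularized p \<mu> (restrict_K2 (\<lambda>g. c * v g)) z =
        c * W_regularized p \<mu> (restrict_K2 v) z"
      by (simp add: W[OF Ind_scale[OF v]] W[OF v] twisted_difference_scale)
  next
    fix t v assume t: "t \<in> (T2 :: 'a mat2 set)" and v: "v \<in> Ind \<xi>1 \<xi>2"
    define a where "a = t $ 1 $ 1 / t $ 2 $ 2"
    have a: "a \<noteq> 0"
      using t by (simp add: T2_iff a_def)
    have "t \<in> G2"
      using t by (simp add: T2_def)
    \<comment> \<open>Multiplication by \<open>a\<close> commutes with division by \<open>p\<close>,
      so the pointwise identity passes through the operator; invariance of the measure then removes
      \<open>a\<close> from the integral.\<close>
    have "twisted_difference p x y (W_integrand \<sigma> (right_translate t v)) s =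
        torus_char \<xi>1 \<xi>2 \<sigma> t * twisted_difference p x y (W_integrand \<sigma> v) (a * s)"
      if "s \<in> space \<mu>" for s
      using that uniformizer_nonzero[OF p] W_integrand_right_translate[OF unr v t, folded a_def]
      by (simp add: twisted_difference_def space algebra_simps)
    then have "(LINT s|\<mu>. twisted_difference p x y (W_integrand \<sigma> (right_translate t v)) s) =
        (LINT s|\<mu>. torus_char \<xi>1 \<xi>2 \<sigma> t * twisted_difference p x y (W_integrand \<sigma> v) (a * s))"
      by (intro Bochner_Integration.integral_cong) simp_all
    also have "\<dots> = torus_char \<xi>1 \<xi>2 \<sigma> t * (LINT s|\<mu>. twisted_difference p x y (W_integrand \<sigma> v) s)"
      using mult_haar_integral_mult[OF \<mu> a borel_measurable_integrable[OF int[OF v]]] by simp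
    finally show "W_regularized p \<mu> (restrict_K2 (right_translate t v)) z =
        torus_char \<xi>1 \<xi>2 \<sigma> t * W_regularized p \<mu> (restrict_K2 v) z"
      by (simp add: W[OF Ind_right_translate[OF v \<open>t \<in> G2\<close>]] W[OF v])
  qed
qed

theorem theorem1p2:
  fixes p :: "'a::nonarch_local_field" and \<mu> :: "'a measure"
  assumes "CHAR('a) \<noteq> 2" and "uniformizer p" and "mult_haar \<mu>"
  shows
    "(\<forall>f\<in>Cinf_K2.
        (\<forall>z\<in>convergence_domain (residue_card TYPE('a)). \<forall>\<xi>1 \<xi>2 \<sigma>.
           has_parameters p \<xi>1 \<xi>2 \<sigma> z \<longrightarrow>
             (\<exists>!\<phi>. Ind_extension \<xi>1 \<xi>2 f \<phi>) \<and>
             (\<forall>\<phi>. Ind_extension \<xi>1 \<xi>2 f \<phi> \<longrightarrow> integrable \<mu> (W_integrand \<sigma> \<phi>))) \<and>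
        (\<exists>A. W_continuation p \<mu> f A)) \<and>
     (\<forall>A. (\<forall>f\<in>Cinf_K2. W_continuation p \<mu> f (A f)) \<longrightarrow>
        (\<forall>z\<in>Lambda_domain (residue_card TYPE('a)). \<forall>\<xi>1 \<xi>2 \<sigma>.
           has_parameters p \<xi>1 \<xi>2 \<sigma> z \<longrightarrow>
             waldspurger_functional \<xi>1 \<xi>2 \<sigma> (\<lambda>\<phi>. A (restrict_K2 \<phi>) z)))"
proof (intro conjI ballI allI impI)
  fix f :: "'a mat2 \<Rightarrow> complex" and z \<xi>1 \<xi>2 \<sigma>
  assume f: "f \<in> Cinf_K2" and z: "z \<in> convergence_domain (residue_card TYPE('a))"
    and h: "has_parameters p \<xi>1 \<xi>2 \<sigma> z"
  show "\<exists>!\<phi>. Ind_extension \<xi>1 \<xi>2 f \<phi>"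
    using ex_Ind_extension[OF f has_parameters_unramified(1,2)[OF h]] Ind_extension_unique
    by blast
  show "integrable \<mu> (W_integrand \<sigma> \<phi>)" if "Ind_extension \<xi>1 \<xi>2 f \<phi>" for \<phi>
    by (rule integrable_W_integrand(1)[OF assms(3,2) f z h that])
next
  fix f :: "'a mat2 \<Rightarrow> complex"
  assume "f \<in> Cinf_K2"
  then show "\<exists>A. W_continuation p \<mu> f A"
    using W_continuation_W_regularized[OF assms(3,2)] by blast
next
  fix A z \<xi>1 \<xi>2 \<sigma>
  assume A: "\<forall>f\<in>Cinf_K2. W_continuation p \<mu> f (A f)"
    and z: "z \<in> Lambda_domain (residue_card TYPE('a))" and h: "has_parameters p \<xi>1 \<xi>2 \<sigma> z"
  note unr = has_parameters_unramified[OF h]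
  \<comment> \<open>The choices made by \<open>A\<close> for different functions are a priori
    unrelated; uniqueness identifies each of them with the explicit formula, which is linear and
    equivariant.\<close>
  have A_eq: "A (restrict_K2 \<phi>) z = W_regularized p \<mu> (restrict_K2 \<phi>) z"
    if "\<phi> \<in> Ind \<xi>1 \<xi>2" for \<phi>
  proof -
    have f: "restrict_K2 \<phi> \<in> Cinf_K2"
      by (rule restrict_K2_in_Cinf_K2[OF that unr(1,2)])
    show ?thesis
      by (rule W_continuation_unique[OF assms(2) f bspec[OF A f]
            W_continuation_W_regularized[OF assms(3,2) f] z])
  qed
  \<comment> \<open>\<open>A_eq\<close> holds on \<open>Ind\<close> only, so sums, multiples and
    torus translates must be known to stay there before it can rewrite them.\<close>
  have "right_translate t v \<in> Ind \<xi>1 \<xi>2" if "t \<in> T2" "v \<in> Ind \<xi>1 \<xi>2" for t v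
    using that Ind_right_translate by (auto simp: T2_def)
  then show "waldspurger_functional \<xi>1 \<xi>2 \<sigma> (\<lambda>\<phi>. A (restrict_K2 \<phi>) z)"
    using waldspurger_functional_W_regularized[OF assms(3,2) h]
    unfolding waldspurger_functional_def by (simp add: A_eq Ind_add Ind_scale)
qed

end
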